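(* Let $a,b>0$ and let $g\in L^2(\mathbb{R})$ be a preframe function for the parameters $a,b$ (i.e. $g\in\mathbf{PF}$). The following are equivalent: (1) The Walnut series $\frac1b\sum_{k\in\mathbb{Z}}(T_{k/b}f)G_k$ converges weakly unconditionally for every $f\in L^2(\mathbb{R})$. (2) The Walnut series $\frac1b\sum_{k\in\mathbb{Z}}(T_{k/b}f)G_k$ converges unconditionally in norm for every $f\in L^2(\mathbb{R})$. (3) $\sup_{M\subset\mathbb{Z},\,|M|<\infty}\|S_M\|<\infty$. (4) The series $$\frac1b\sum_{k\in\mathbb{Z}}\langle(T_{k/b}f)G_k,f\rangle$$ converges unconditionally to $\langle Sf,f\rangle$, for all $f\in L^2(\mathbb{R})$. (5) For all $f\in L^2(\mathbb{R})$ the WH-frame Identity $$\sum_{m,n\in\mathbb{Z}}|\langle f,E_{mb}T_{na}g\rangle|^2=\frac1b\sum_{k\in\mathbb{Z}}\int_{\mathbb{R}}\overline{f(t)}f(t-k/b)G_k(t)\,dt$$ holds and the series on the right-hand side converges unconditionally.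
   Context: For $c\in\mathbb{R}$ let $T_cf(x)=f(x-c)$ and $E_cf(x)=e^{2\pi i c x}f(x)$. $g\in\mathbf{PF}$ means that $(g,a,b)=(E_{mb}T_{na}g)_{m,n\in\mathbb{Z}}$ has a finite upper frame bound: there is $B<\infty$ with $\sum_{m,n\in\mathbb{Z}}|\langle f,E_{mb}T_{na}g\rangle|^2\le B\|f\|^2$ for all $f\in L^2(\mathbb{R})$. Equivalently, $Sf=\sum_{m,n\in\mathbb{Z}}\langle f,E_{mb}T_{na}g\rangle E_{mb}T_{na}g$ is a well-defined bounded linear operator on $L^2(\mathbb{R})$. For $k\in\mathbb{Z}$ put $G_k(t)=\sum_{n\in\mathbb{Z}}g(t-na)\overline{g(t-na-k/b)}$. For a finite set $M\subset\mathbb{Z}$ and $f\in L^2(\mathbb{R})$ let $S_Mf(t)=\sum_{k\in M}f(t-k/b)G_k(t)$, and let $\|S_M\|$ be its operator norm on $L^2(\mathbb{R})$. *)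

theory Defs
  imports "HOL-Analysis.Analysis"
begin

text \<open>
  Elements of \<open>L\<^sup>2(\<real>)\<close> are represented by Borel measurable functions; every class of Lebesgue
  measurable functions modulo a.e. equality contains one. Everything below that is evaluated on
  such functions is invariant under changes on a null set.
\<close>

definition L2 :: "(real \<Rightarrow> complex) set" where
  "L2 = {f \<in> borel_measurable lborel. integrable lborel (\<lambda>t. (cmod (f t))\<^sup>2)}"

definition l2_inner :: "(real \<Rightarrow> complex) \<Rightarrow> (real \<Rightarrow> complex) \<Rightarrow> complex" where
  "l2_inner f h = (LINT t|lborel. f t * cnj (h t))"

definition l2_norm :: "(real \<Rightarrow> complex) \<Rightarrow> real" where
  "l2_norm f = sqrt (LINT t|lborel. (cmod (f t))\<^sup>2)"

text \<open>
  Unconditional convergence is convergence of the net of finite partial sums, as in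
  \<^const>\<open>has_sum\<close>. The limits are unique only up to a.e. equality.
\<close>

definition l2_has_sum :: "('i \<Rightarrow> real \<Rightarrow> complex) \<Rightarrow> (real \<Rightarrow> complex) \<Rightarrow> bool" where
  "l2_has_sum x u \<longleftrightarrow> (\<forall>i. x i \<in> L2) \<and> u \<in> L2 \<and>
     ((\<lambda>F. l2_norm (\<lambda>t. (\<Sum>i\<in>F. x i t) - u t)) \<longlongrightarrow> 0) (finite_subsets_at_top UNIV)"

definition l2_has_weak_sum :: "('i \<Rightarrow> real \<Rightarrow> complex) \<Rightarrow> (real \<Rightarrow> complex) \<Rightarrow> bool" where
  "l2_has_weak_sum x u \<longleftrightarrow> (\<forall>i. x i \<in> L2) \<and> u \<in> L2 \<and>
     (\<forall>h\<in>L2. ((\<lambda>i. l2_inner (x i) h) has_sum l2_inner u h) UNIV)"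

text \<open>The value is \<open>\<infinity>\<close> if \<open>T\<close> does not map \<^const>\<open>L2\<close> boundedly into \<^const>\<open>L2\<close>.\<close>

definition l2_opnorm :: "((real \<Rightarrow> complex) \<Rightarrow> (real \<Rightarrow> complex)) \<Rightarrow> ereal" where
  "l2_opnorm T =
     (INF C \<in> {C::real. 0 \<le> C \<and> (\<forall>f\<in>L2. T f \<in> L2 \<and> l2_norm (T f) \<le> C * l2_norm f)}. ereal C)"

definition translation :: "real \<Rightarrow> (real \<Rightarrow> complex) \<Rightarrow> real \<Rightarrow> complex" where
  "translation c f x = f (x - c)"

definition modulation :: "real \<Rightarrow> (real \<Rightarrow> complex) \<Rightarrow> real \<Rightarrow> complex" where
  "modulation c f x = exp (2 * complex_of_real pi * \<i> * complex_of_real c * complex_of_real x) * f x"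

definition wh :: "(real \<Rightarrow> complex) \<Rightarrow> real \<Rightarrow> real \<Rightarrow> int \<times> int \<Rightarrow> real \<Rightarrow> complex" where
  "wh g a b = (\<lambda>(m, n). modulation (of_int m * b) (translation (of_int n * a) g))"

definition PF :: "real \<Rightarrow> real \<Rightarrow> (real \<Rightarrow> complex) set" where
  "PF a b = {g \<in> L2. \<exists>B::real. \<forall>f\<in>L2.
     (\<lambda>p. (cmod (l2_inner f (wh g a b p)))\<^sup>2) summable_on UNIV \<and>
     (\<Sum>\<^sub>\<infinity>p. (cmod (l2_inner f (wh g a b p)))\<^sup>2) \<le> B * (l2_norm f)\<^sup>2}"

text \<open>For \<open>g \<in> PF a b\<close> the series converges unconditionally in norm, and the choice below only
  picks a representative of its sum.\<close>

definition frame_operator ::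
    "(real \<Rightarrow> complex) \<Rightarrow> real \<Rightarrow> real \<Rightarrow> (real \<Rightarrow> complex) \<Rightarrow> real \<Rightarrow> complex" where
  "frame_operator g a b f =
     (SOME u. l2_has_sum (\<lambda>p t. l2_inner f (wh g a b p) * wh g a b p t) u)"

text \<open>For \<open>g \<in> L2\<close> and \<open>a > 0\<close> the series converges absolutely for a.e. \<open>t\<close>; at the remaining
  points \<^const>\<open>infsum\<close> assigns the value \<open>0\<close>.\<close>

definition walnut_G :: "(real \<Rightarrow> complex) \<Rightarrow> real \<Rightarrow> real \<Rightarrow> int \<Rightarrow> real \<Rightarrow> complex" where
  "walnut_G g a b k t =
     (\<Sum>\<^sub>\<infinity>n::int. g (t - of_int n * a) * cnj (g (t - of_int n * a - of_int k / b)))"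

definition walnut_partial ::
    "(real \<Rightarrow> complex) \<Rightarrow> real \<Rightarrow> real \<Rightarrow> int set \<Rightarrow> (real \<Rightarrow> complex) \<Rightarrow> real \<Rightarrow> complex" where
  "walnut_partial g a b M f t = (\<Sum>k\<in>M. f (t - of_int k / b) * walnut_G g a b k t)"

definition walnut_term ::
    "(real \<Rightarrow> complex) \<Rightarrow> real \<Rightarrow> real \<Rightarrow> (real \<Rightarrow> complex) \<Rightarrow> int \<Rightarrow> real \<Rightarrow> complex" where
  "walnut_term g a b f k t = translation (of_int k / b) f t * walnut_G g a b k t"

end

theory Submission
  imports Defs
begin

text \<open>
  The proof cuts the line into the windows \<open>I\<^sub>j = [j/b, (j+1)/b)\<close>. If \<open>f\<close> is supported in
  \<open>I\<^sub>i\<close>, then \<open>(T\<^bsub>k/b\<^esub> f) G\<^sub>k\<close> is supported in \<open>I\<^bsub>i+k\<^esub>\<close>, so the terms of the Walnut series of \<open>f\<close> are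
  pairwise orthogonal and \<open>\<parallel>S\<^sub>M f\<parallel>\<^sup>2\<close> is the sum of their squared norms
  (\<open>walnut_partial_Pythagoras\<close>). Bounded partial sums therefore already converge unconditionally
  for such an \<open>f\<close>. Finite sums of windowed functions are dense, and a bound on the
  \<open>\<parallel>S\<^sub>M\<parallel>\<close> that is uniform in \<open>M\<close> carries the Cauchy criterion over to every \<open>f\<close>
  (\<open>tail_small_all\<close>). So a uniform bound implies unconditional convergence in norm, which implies
  weak unconditional convergence. The way back from weak convergence to a uniform bound is the
  uniform boundedness principle, applied first in the second and then in the first argument of
  \<open>\<langle>S\<^sub>M f, h\<rangle>\<close> (\<open>weakly_summable_imp_uniform_bound\<close>).

  To identify the sum of the Walnut series with \<open>Sf\<close>, let \<open>f\<close> be supported in \<open>I\<^sub>i\<close> and \<open>h\<close>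
  in \<open>I\<^sub>j\<close>. For fixed \<open>n\<close> the sum over \<open>m\<close> of \<open>\<langle>f, E\<^bsub>mb\<^esub> T\<^bsub>na\<^esub> g\<rangle>\<close> times the conjugate of \<open>\<langle>h, E\<^bsub>mb\<^esub> T\<^bsub>na\<^esub> g\<rangle>\<close> is
  evaluated by Parseval's formula on an interval of length \<open>1/b\<close>. Summing over \<open>n\<close> gives
  \<open>\<langle>Sf, h\<rangle> = (1/b) \<langle>(T\<^bsub>k/b\<^esub> f) G\<^sub>k, h\<rangle>\<close> with \<open>k = j - i\<close> (\<open>Walnut_on_windows\<close>), and all other terms
  of the Walnut series are orthogonal to \<open>h\<close>. If the \<open>S\<^sub>M\<close> are uniformly bounded, both \<open>Sf\<close> and
  the sum of the Walnut series define bounded forms; they agree on windowed functions, hence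
  everywhere (\<open>uniform_bound_imp_Walnut_representation\<close>). Conversely, convergence of the series
  of quadratic forms makes \<open>\<langle>(T\<^bsub>k/b\<^esub> f) G\<^sub>k, h\<rangle>\<close> summable in \<open>k\<close> by polarization, and the
  uniform boundedness principle applies again. Finally, since
  \<open>\<langle>Sf, f\<rangle> = \<Sum> |\<langle>f, E\<^bsub>mb\<^esub> T\<^bsub>na\<^esub> g\<rangle>|\<^sup>2\<close>, the frame identity is the statement about quadratic
  forms in other words.

  The preframe condition enters through \<open>square_sum_le\<close>: testing the frame bound \<open>B\<close> on indicator
  functions gives \<open>\<Sum>\<^sub>n |g(t - na)|\<^sup>2 \<le> bB\<close> almost everywhere, hence \<open>|G\<^sub>k| \<le> bB\<close>, and every
  \<open>S\<^sub>M\<close> is bounded. The functional analysis needed on the way (Riesz--Fischer, uniform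
  boundedness, and completeness of the exponentials on an interval) is developed first, directly
  for square-integrable functions.
\<close>

section \<open>The space of square-integrable functions\<close>

lemma L2_measurable: "f \<in> L2 \<Longrightarrow> f \<in> borel_measurable lborel"
  by (simp add: L2_def)

lemma L2_integrable_sq: "f \<in> L2 \<Longrightarrow> integrable lborel (\<lambda>t. (cmod (f t))\<^sup>2)"
  by (simp add: L2_def)

lemma L2_I:
  "f \<in> borel_measurable lborel \<Longrightarrow> integrable lborel (\<lambda>t. (cmod (f t))\<^sup>2) \<Longrightarrow> f \<in> L2"
  by (simp add: L2_def)

lemma L2_dominated:
  assumes "f \<in> L2" "h \<in> borel_measurable lborel" "AE t in lborel. cmod (h t) \<le> C * cmod (f t)"
  shows "h \<in> L2"
proof (rule L2_I)
  show "integrable lborel (\<lambda>t. (cmod (h t))\<^sup>2)"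
  proof (rule Bochner_Integration.integrable_bound)
    show "integrable lborel (\<lambda>t. C\<^sup>2 * (cmod (f t))\<^sup>2)"
      using L2_integrable_sq[OF assms(1)] by simp
    show "AE t in lborel. norm ((cmod (h t))\<^sup>2) \<le> norm (C\<^sup>2 * (cmod (f t))\<^sup>2)"
      using assms(3)
    proof eventually_elim
      case (elim t)
      then have "(cmod (h t))\<^sup>2 \<le> (C * cmod (f t))\<^sup>2"
        by (intro power_mono) auto
      then show ?case by (simp add: power_mult_distrib)
    qed
  qed (use assms(2) in measurable)
qed fact

lemma L2_scale: "f \<in> L2 \<Longrightarrow> (\<lambda>t. c * f t) \<in> L2"
  using L2_measurable[of f] by (rule_tac L2_dominated[of f _ "cmod c"]) (simp_all add: norm_mult)

lemma L2_uminus: "f \<in> L2 \<Longrightarrow> (\<lambda>t. - f t) \<in> L2"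
  using L2_scale[of f "-1"] by simp

lemma L2_add:
  assumes "f \<in> L2" "h \<in> L2" shows "(\<lambda>t. f t + h t) \<in> L2"
proof (rule L2_I)
  note [measurable] = L2_measurable[OF assms(1)] L2_measurable[OF assms(2)]
  show "(\<lambda>t. f t + h t) \<in> borel_measurable lborel" by measurable
  show "integrable lborel (\<lambda>t. (cmod (f t + h t))\<^sup>2)"
  proof (rule Bochner_Integration.integrable_bound)
    show "integrable lborel (\<lambda>t. 2 * (cmod (f t))\<^sup>2 + 2 * (cmod (h t))\<^sup>2)"
      using assms by (simp add: L2_integrable_sq)
    have "(cmod (f t + h t))\<^sup>2 \<le> 2 * (cmod (f t))\<^sup>2 + 2 * (cmod (h t))\<^sup>2" for t
    proof -
      have "(cmod (f t + h t))\<^sup>2 \<le> (cmod (f t) + cmod (h t))\<^sup>2"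
        by (intro power_mono norm_triangle_ineq) auto
      also have "\<dots> \<le> 2 * (cmod (f t))\<^sup>2 + 2 * (cmod (h t))\<^sup>2"
        using sum_squares_bound[of "cmod (f t)" "cmod (h t)"] by (simp add: power2_sum)
      finally show ?thesis .
    qed
    then show "AE t in lborel. norm ((cmod (f t + h t))\<^sup>2)
        \<le> norm (2 * (cmod (f t))\<^sup>2 + 2 * (cmod (h t))\<^sup>2)" by simp
  qed measurable
qed

lemma L2_diff: "f \<in> L2 \<Longrightarrow> h \<in> L2 \<Longrightarrow> (\<lambda>t. f t - h t) \<in> L2"
  using L2_add[OF _ L2_uminus, of f h] by simp

lemma L2_zero: "(\<lambda>t. 0) \<in> L2"
  by (auto intro: L2_I)

lemma L2_sum: "(\<And>i. i \<in> I \<Longrightarrow> x i \<in> L2) \<Longrightarrow> (\<lambda>t. \<Sum>i\<in>I. x i t) \<in> L2"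
  by (induction I rule: infinite_finite_induct) (auto simp: L2_zero L2_add)

lemma L2_indicator_mult:
  assumes "f \<in> L2" "A \<in> sets borel" shows "(\<lambda>t. indicator A t * f t) \<in> L2"
  using L2_measurable[OF assms(1)] assms
  by (rule_tac L2_dominated[of f _ 1]) (auto split: split_indicator)

lemma L2_translate:
  assumes "f \<in> L2" shows "(\<lambda>t. f (t - c)) \<in> L2"
proof (rule L2_I)
  have [measurable]: "f \<in> borel_measurable borel" using L2_measurable[OF assms] by simp
  show "(\<lambda>t. f (t - c)) \<in> borel_measurable lborel" by simp
  show "integrable lborel (\<lambda>t. (cmod (f (t - c)))\<^sup>2)"
    using lborel_integrable_real_affine[OF L2_integrable_sq[OF assms], of 1 "-c"] by simp
qed

lemma integral_translate:
  "(LINT t|lborel. f (t - c)) = (LINT t|lborel. (f t :: 'a::{banach,second_countable_topology}))"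
  for c :: real
  using lborel_integral_real_affine[of 1 f "-c"] by simp

lemma integrable_inner:
  assumes "f \<in> L2" "h \<in> L2" shows "integrable lborel (\<lambda>t. f t * cnj (h t))"
proof (rule Bochner_Integration.integrable_bound)
  note [measurable] = L2_measurable[OF assms(1)] L2_measurable[OF assms(2)]
  show "integrable lborel (\<lambda>t. (cmod (f t))\<^sup>2 + (cmod (h t))\<^sup>2)"
    using assms by (simp add: L2_integrable_sq)
  have "norm (f t * cnj (h t)) \<le> norm ((cmod (f t))\<^sup>2 + (cmod (h t))\<^sup>2)" for t
  proof -
    have "0 \<le> cmod (f t) * cmod (h t)" by simp
    moreover have "2 * (cmod (f t) * cmod (h t)) \<le> (cmod (f t))\<^sup>2 + (cmod (h t))\<^sup>2"
      using sum_squares_bound[of "cmod (f t)" "cmod (h t)"] by (simp add: mult.assoc)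
    ultimately show ?thesis unfolding norm_mult complex_mod_cnj real_norm_def by linarith
  qed
  then show "AE t in lborel. norm (f t * cnj (h t)) \<le> norm ((cmod (f t))\<^sup>2 + (cmod (h t))\<^sup>2)"
    by simp
  have "cnj \<in> borel_measurable borel"
    by (intro borel_measurable_continuous_onI continuous_intros)
  then show "(\<lambda>t. f t * cnj (h t)) \<in> borel_measurable lborel" by measurable
qed

lemma l2_inner_add_left:
  "f \<in> L2 \<Longrightarrow> f' \<in> L2 \<Longrightarrow> h \<in> L2 \<Longrightarrow>
    l2_inner (\<lambda>t. f t + f' t) h = l2_inner f h + l2_inner f' h"
  unfolding l2_inner_def
  by (simp add: distrib_right Bochner_Integration.integral_add[OF integrable_inner integrable_inner])

lemma l2_inner_scale_left: "l2_inner (\<lambda>t. c * f t) h = c * l2_inner f h"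
  unfolding l2_inner_def by (simp add: mult.assoc)

lemma l2_inner_cnj: "l2_inner h f = cnj (l2_inner f h)"
  unfolding l2_inner_def
  using Bochner_Integration.integral_cnj[of lborel "\<lambda>t. f t * cnj (h t)"] by (simp add: mult.commute)

lemma l2_inner_add_right:
  "f \<in> L2 \<Longrightarrow> h \<in> L2 \<Longrightarrow> h' \<in> L2 \<Longrightarrow>
    l2_inner f (\<lambda>t. h t + h' t) = l2_inner f h + l2_inner f h'"
  using l2_inner_add_left[of h h' f] by (simp add: l2_inner_cnj[of f])

lemma l2_inner_scale_right: "l2_inner f (\<lambda>t. c * h t) = cnj c * l2_inner f h"
  using l2_inner_scale_left[of c h f] by (simp add: l2_inner_cnj[of f])

lemma l2_inner_diff_left:
  "f \<in> L2 \<Longrightarrow> f' \<in> L2 \<Longrightarrow> h \<in> L2 \<Longrightarrow>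
    l2_inner (\<lambda>t. f t - f' t) h = l2_inner f h - l2_inner f' h"
  using l2_inner_add_left[of f "\<lambda>t. (-1) * f' t" h] L2_scale[of f' "-1"]
    l2_inner_scale_left[of "-1" f' h]
  by simp

lemma l2_inner_sum_left:
  assumes "\<And>i. i \<in> I \<Longrightarrow> x i \<in> L2" "h \<in> L2"
  shows "l2_inner (\<lambda>t. \<Sum>i\<in>I. x i t) h = (\<Sum>i\<in>I. l2_inner (x i) h)"
  using assms(1)
proof (induction I rule: infinite_finite_induct)
  case (insert i I)
  then show ?case
    using l2_inner_add_left[of "x i" "\<lambda>t. \<Sum>i\<in>I. x i t" h] L2_sum[of I x] assms(2) by simp
qed (simp_all add: l2_inner_def)

lemma l2_norm_nonneg [simp]: "0 \<le> l2_norm f"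
  by (simp add: l2_norm_def)

lemma l2_norm_sq: "(l2_norm f)\<^sup>2 = (LINT t|lborel. (cmod (f t))\<^sup>2)"
  by (simp add: l2_norm_def)

lemma l2_inner_self: "l2_inner f f = complex_of_real ((l2_norm f)\<^sup>2)"
  unfolding l2_norm_sq l2_inner_def
  by (simp add: integral_complex_of_real[symmetric] complex_norm_square[symmetric])

lemma l2_norm_sq_nn:
  "f \<in> L2 \<Longrightarrow> ennreal ((l2_norm f)\<^sup>2) = (\<integral>\<^sup>+t. ennreal ((cmod (f t))\<^sup>2) \<partial>lborel)"
  unfolding l2_norm_sq by (rule nn_integral_eq_integral[symmetric]) (auto intro: L2_integrable_sq)

lemma l2_Cauchy_Schwarz:
  assumes "f \<in> L2" "h \<in> L2" shows "cmod (l2_inner f h) \<le> l2_norm f * l2_norm h"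
proof -
  note [measurable] = L2_measurable[OF assms(1)] L2_measurable[OF assms(2)]
  let ?I = "LINT t|lborel. cmod (f t) * cmod (h t)"
  have int: "integrable lborel (\<lambda>t. cmod (f t) * cmod (h t))"
    using integrable_norm[OF integrable_inner[OF assms]] by (simp add: norm_mult)
  have "ennreal (?I\<^sup>2) = (ennreal ?I)\<^sup>2"
    by (simp add: ennreal_power)
  also have "ennreal ?I = (\<integral>\<^sup>+t. ennreal (cmod (f t)) * ennreal (cmod (h t)) \<partial>lborel)"
    using int by (subst nn_integral_eq_integral[symmetric]) (auto simp: ennreal_mult)
  also have "\<dots>\<^sup>2 \<le> (\<integral>\<^sup>+t. ennreal (cmod (f t))^2 \<partial>lborel) * (\<integral>\<^sup>+t. ennreal (cmod (h t))^2 \<partial>lborel)"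
    by (rule Cauchy_Schwarz_nn_integral) measurable
  also have "\<dots> = ennreal ((l2_norm f)\<^sup>2 * (l2_norm h)\<^sup>2)"
    using l2_norm_sq_nn[OF assms(1)] l2_norm_sq_nn[OF assms(2)]
    by (simp add: ennreal_power ennreal_mult)
  finally have "?I\<^sup>2 \<le> (l2_norm f * l2_norm h)\<^sup>2"
    by (simp add: power_mult_distrib)
  then have "?I \<le> l2_norm f * l2_norm h"
    by (rule power2_le_imp_le) simp
  moreover have "cmod (l2_inner f h) \<le> ?I"
    unfolding l2_inner_def
    using integral_norm_bound[of lborel "\<lambda>t. f t * cnj (h t)"] by (simp add: norm_mult)
  ultimately show ?thesis by simp
qed

lemma l2_norm_add_sq:
  assumes "f \<in> L2" "h \<in> L2"
  shows "(l2_norm (\<lambda>t. f t + h t))\<^sup>2 = (l2_norm f)\<^sup>2 + 2 * Re (l2_inner f h) + (l2_norm h)\<^sup>2"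
proof -
  have "complex_of_real ((l2_norm (\<lambda>t. f t + h t))\<^sup>2)
      = l2_inner f f + l2_inner f h + (cnj (l2_inner f h) + l2_inner h h)"
    unfolding l2_inner_self[symmetric]
    using assms by (simp add: l2_inner_add_left l2_inner_add_right L2_add l2_inner_cnj[of h f])
  then have "Re (complex_of_real ((l2_norm (\<lambda>t. f t + h t))\<^sup>2))
      = Re (l2_inner f f + l2_inner f h + (cnj (l2_inner f h) + l2_inner h h))"
    by simp
  then show ?thesis by (simp add: l2_inner_self)
qed

lemma l2_norm_triangle:
  assumes "f \<in> L2" "h \<in> L2" shows "l2_norm (\<lambda>t. f t + h t) \<le> l2_norm f + l2_norm h"
proof (rule power2_le_imp_le)
  have "Re (l2_inner f h) \<le> l2_norm f * l2_norm h"
    using l2_Cauchy_Schwarz[OF assms] complex_Re_le_cmod order_trans by blast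
  then show "(l2_norm (\<lambda>t. f t + h t))\<^sup>2 \<le> (l2_norm f + l2_norm h)\<^sup>2"
    unfolding l2_norm_add_sq[OF assms] by (simp add: power2_sum)
qed simp

lemma l2_norm_scale: "l2_norm (\<lambda>t. c * f t) = cmod c * l2_norm f"
  unfolding l2_norm_def by (simp add: norm_mult power_mult_distrib real_sqrt_mult)

lemma l2_norm_minus_commute: "l2_norm (\<lambda>t. f t - h t) = l2_norm (\<lambda>t. h t - f t)"
  unfolding l2_norm_def by (simp add: norm_minus_commute)

lemma l2_norm_zero [simp]: "l2_norm (\<lambda>t. 0) = 0"
  by (simp add: l2_norm_def)

lemma l2_dist_triangle:
  assumes "f \<in> L2" "u \<in> L2" "h \<in> L2"
  shows "l2_norm (\<lambda>t. f t - h t) \<le> l2_norm (\<lambda>t. f t - u t) + l2_norm (\<lambda>t. u t - h t)"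
  using l2_norm_triangle[OF L2_diff[OF assms(1,2)] L2_diff[OF assms(2,3)]] by simp

lemma l2_norm_mono:
  assumes "f \<in> L2" "h \<in> L2" "AE t in lborel. cmod (h t) \<le> C * cmod (f t)" "0 \<le> C"
  shows "l2_norm h \<le> C * l2_norm f"
proof (rule power2_le_imp_le)
  have "(LINT t|lborel. (cmod (h t))\<^sup>2) \<le> (LINT t|lborel. C\<^sup>2 * (cmod (f t))\<^sup>2)"
  proof (rule integral_mono_AE)
    show "AE t in lborel. (cmod (h t))\<^sup>2 \<le> C\<^sup>2 * (cmod (f t))\<^sup>2"
      using assms(3)
    proof eventually_elim
      case (elim t)
      then have "(cmod (h t))\<^sup>2 \<le> (C * cmod (f t))\<^sup>2" by (intro power_mono) auto
      then show ?case by (simp add: power_mult_distrib)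
    qed
  qed (use assms L2_integrable_sq in auto)
  then show "(l2_norm h)\<^sup>2 \<le> (C * l2_norm f)\<^sup>2"
    by (simp add: l2_norm_sq power_mult_distrib)
qed (use assms in simp)

lemma l2_norm_sum_le:
  assumes "\<And>i. i \<in> I \<Longrightarrow> x i \<in> L2"
  shows "l2_norm (\<lambda>t. \<Sum>i\<in>I. x i t) \<le> (\<Sum>i\<in>I. l2_norm (x i))"
  using assms
proof (induction I rule: infinite_finite_induct)
  case (insert i I)
  then show ?case
    using l2_norm_triangle[of "x i" "\<lambda>t. \<Sum>i\<in>I. x i t"] L2_sum[of I x]
    by (simp add: order_trans[OF _ add_left_mono])
qed simp_all

section \<open>Completeness and its consequences\<close>

lemma l2_norm_telescope:
  fixes x :: "nat \<Rightarrow> real \<Rightarrow> complex"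
  assumes "\<And>n. x n \<in> L2" "\<And>n. l2_norm (\<lambda>t. x (Suc n) t - x n t) \<le> r ^ n" "0 \<le> r" "r < 1"
  shows "l2_norm (\<lambda>t. x (n + k) t - x n t) \<le> r ^ n / (1 - r)"
proof -
  have "l2_norm (\<lambda>t. x (n + k) t - x n t) \<le> (\<Sum>j<k. r ^ (n + j))"
  proof (induction k)
    case (Suc k)
    have "l2_norm (\<lambda>t. x (n + Suc k) t - x n t)
        \<le> l2_norm (\<lambda>t. x (Suc (n + k)) t - x (n + k) t) + l2_norm (\<lambda>t. x (n + k) t - x n t)"
      using l2_dist_triangle[OF assms(1)[of "n + Suc k"] assms(1)[of "n + k"] assms(1)[of n]] by simp
    with Suc assms(2)[of "n + k"] show ?case by simp
  qed simp
  also have "\<dots> = r ^ n * (\<Sum>j<k. r ^ j)"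
    by (simp add: power_add sum_distrib_left)
  also have "(\<Sum>j<k. r ^ j) \<le> (\<Sum>j. r ^ j)"
    using assms(3,4) by (intro sum_le_suminf) (auto intro: summable_geometric)
  also have "(\<Sum>j. r ^ j) = 1 / (1 - r)"
    using assms(3,4) by (intro suminf_geometric) auto
  finally show ?thesis using assms(3) by (simp add: mult_left_mono)
qed

text \<open>
  The increments have summable norms, so by monotone convergence their absolute values have a sum
  that is finite almost everywhere, and the sequence converges pointwise almost everywhere. Fatou's
  lemma turns this into convergence in norm.
\<close>

theorem Riesz_Fischer:
  fixes x :: "nat \<Rightarrow> real \<Rightarrow> complex"
  assumes x: "\<And>n. x n \<in> L2" and step: "\<And>n. l2_norm (\<lambda>t. x (Suc n) t - x n t) \<le> (1/2) ^ n"
  shows "\<exists>u\<in>L2. (\<lambda>n. l2_norm (\<lambda>t. x n t - u t)) \<longlonglongrightarrow> 0"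
proof -
  note [measurable] = L2_measurable[OF x]
  define d where "d n t = cmod (x (Suc n) t - x n t)" for n t
  have [measurable]: "d n \<in> borel_measurable lborel" for n
    unfolding d_def by measurable
  define s where "s N t = (\<Sum>n<N. d n t)" for N t
  have [measurable]: "s N \<in> borel_measurable lborel" for N
    unfolding s_def by measurable
  have d_L2: "(\<lambda>t. complex_of_real (d n t)) \<in> L2" for n
    unfolding d_def
    by (rule L2_dominated[OF L2_diff[OF x[of "Suc n"] x[of n]], where C = 1]) auto
  have s_nn: "(\<integral>\<^sup>+t. ennreal ((s N t)\<^sup>2) \<partial>lborel) \<le> 4" for N
  proof -
    have "l2_norm (\<lambda>t. \<Sum>n<N. complex_of_real (d n t)) \<le> (\<Sum>n<N. (1/2) ^ n)"
      using l2_norm_sum_le[of "{..<N}" "\<lambda>n t. complex_of_real (d n t)", OF d_L2]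
        sum_mono[of "{..<N}" "\<lambda>n. l2_norm (\<lambda>t. x (Suc n) t - x n t)" "\<lambda>n. (1/2) ^ n"] step
      by (simp add: d_def l2_norm_def)
    also have "\<dots> \<le> (\<Sum>n. (1/2::real) ^ n)"
      by (intro sum_le_suminf) (auto intro: summable_geometric)
    also have "\<dots> = 2" by (simp add: suminf_geometric)
    finally have "(l2_norm (\<lambda>t. \<Sum>n<N. complex_of_real (d n t)))\<^sup>2 \<le> 2\<^sup>2"
      by (intro power_mono) auto
    then have "ennreal ((l2_norm (\<lambda>t. \<Sum>n<N. complex_of_real (d n t)))\<^sup>2) \<le> 4"
      using ennreal_leI[of _ 4] by simp
    also have "ennreal ((l2_norm (\<lambda>t. \<Sum>n<N. complex_of_real (d n t)))\<^sup>2)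
        = (\<integral>\<^sup>+t. ennreal ((s N t)\<^sup>2) \<partial>lborel)"
      by (subst l2_norm_sq_nn[OF L2_sum[OF d_L2]]) (simp add: s_def flip: of_real_sum)
    finally show ?thesis .
  qed
  have s_mono: "s N t \<le> s M t" if "N \<le> M" for N M t
    unfolding s_def using that by (intro sum_mono2) (auto simp: d_def)
  have s_nonneg: "0 \<le> s N t" for N t
    unfolding s_def by (intro sum_nonneg) (auto simp: d_def)
  have "(\<integral>\<^sup>+t. (SUP N. ennreal ((s N t)\<^sup>2)) \<partial>lborel) = (SUP N. \<integral>\<^sup>+t. ennreal ((s N t)\<^sup>2) \<partial>lborel)"
    by (rule nn_integral_monotone_convergence_SUP)
      (auto simp: incseq_def le_fun_def intro!: ennreal_leI power_mono s_mono s_nonneg)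
  also have "\<dots> \<le> 4" by (intro SUP_least s_nn)
  finally have fin: "(\<integral>\<^sup>+t. (SUP N. ennreal ((s N t)\<^sup>2)) \<partial>lborel) \<noteq> \<infinity>"
    by (auto simp: top_unique)
  have "AE t in lborel. (SUP N. ennreal ((s N t)\<^sup>2)) \<noteq> \<infinity>"
    by (rule nn_integral_noteq_infinite[OF _ fin]) measurable
  then have conv: "AE t in lborel. convergent (\<lambda>n. x n t)"
  proof eventually_elim
    case (elim t)
    then obtain K where K: "(SUP N. ennreal ((s N t)\<^sup>2)) = ennreal K" "0 \<le> K"
      by (cases "SUP N. ennreal ((s N t)\<^sup>2)") auto
    have "s N t \<le> sqrt K" for N
    proof -
      have "ennreal ((s N t)\<^sup>2) \<le> ennreal K"
        unfolding K(1)[symmetric] by (rule SUP_upper) simp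
      then show ?thesis using K(2) by (simp add: real_le_rsqrt)
    qed
    then have "summable (\<lambda>n. d n t)"
      by (intro summableI_nonneg_bounded[of _ "sqrt K"]) (auto simp: s_def d_def)
    then have "summable (\<lambda>n. x (Suc n) t - x n t)"
      unfolding d_def by (rule summable_norm_cancel)
    then obtain l where "(\<lambda>m. \<Sum>n<m. x (Suc n) t - x n t) \<longlonglongrightarrow> l"
      by (auto simp: summable_def sums_def)
    then have "(\<lambda>m. x m t - x 0 t + x 0 t) \<longlonglongrightarrow> l + x 0 t"
      unfolding sum_lessThan_telescope[of "\<lambda>n. x n t"] by (intro tendsto_add tendsto_const)
    then show ?case by (auto simp: convergent_def)
  qed
  define u where "u t = lim (\<lambda>n. x n t)" for t
  have [measurable]: "u \<in> borel_measurable lborel"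
    unfolding u_def by measurable
  have lim: "AE t in lborel. (\<lambda>n. x n t) \<longlonglongrightarrow> u t"
    using conv by eventually_elim (simp add: u_def convergent_LIMSEQ_iff)
  have bound: "(\<integral>\<^sup>+t. ennreal ((cmod (x n t - u t))\<^sup>2) \<partial>lborel) \<le> ennreal ((2 * (1/2) ^ n)\<^sup>2)" for n
  proof -
    have "(\<integral>\<^sup>+t. ennreal ((cmod (x n t - u t))\<^sup>2) \<partial>lborel)
        = (\<integral>\<^sup>+t. liminf (\<lambda>k. ennreal ((cmod (x (n + k) t - x n t))\<^sup>2)) \<partial>lborel)"
    proof (rule nn_integral_cong_AE)
      show "AE t in lborel. ennreal ((cmod (x n t - u t))\<^sup>2)
          = liminf (\<lambda>k. ennreal ((cmod (x (n + k) t - x n t))\<^sup>2))"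
        using lim
      proof eventually_elim
        case (elim t)
        then have "(\<lambda>k. x (n + k) t) \<longlonglongrightarrow> u t"
          using LIMSEQ_ignore_initial_segment[of "\<lambda>n. x n t" "u t" n] by (simp add: add.commute)
        then have "(\<lambda>k. ennreal ((cmod (x (n + k) t - x n t))\<^sup>2)) \<longlonglongrightarrow> ennreal ((cmod (u t - x n t))\<^sup>2)"
          by (intro tendsto_intros)
        from lim_imp_Liminf[OF _ this] show ?case
          by (simp add: norm_minus_commute[of "u t"])
      qed
    qed
    also have "\<dots> \<le> liminf (\<lambda>k. \<integral>\<^sup>+t. ennreal ((cmod (x (n + k) t - x n t))\<^sup>2) \<partial>lborel)"
      by (rule nn_integral_liminf) measurable
    also have "\<dots> \<le> ennreal ((2 * (1/2) ^ n)\<^sup>2)"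
    proof (rule Liminf_le, simp, rule always_eventually, rule allI)
      fix k
      have "l2_norm (\<lambda>t. x (n + k) t - x n t) \<le> 2 * (1/2) ^ n"
        using l2_norm_telescope[OF x step, of n k] by simp
      then show "(\<integral>\<^sup>+t. ennreal ((cmod (x (n + k) t - x n t))\<^sup>2) \<partial>lborel) \<le> ennreal ((2 * (1/2) ^ n)\<^sup>2)"
        by (subst l2_norm_sq_nn[OF L2_diff[OF x x], symmetric]) (intro ennreal_leI power_mono, auto)
    qed
    finally show ?thesis .
  qed
  have diff: "(\<lambda>t. x n t - u t) \<in> L2" for n
  proof (rule L2_I)
    show "integrable lborel (\<lambda>t. (cmod (x n t - u t))\<^sup>2)"
    proof (rule integrableI_bounded)
      show "(\<integral>\<^sup>+t. ennreal (norm ((cmod (x n t - u t))\<^sup>2)) \<partial>lborel) < \<infinity>"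
        using le_less_trans[OF bound[of n] ennreal_less_top] by simp
    qed measurable
  qed measurable
  have le: "l2_norm (\<lambda>t. x n t - u t) \<le> 2 * (1/2) ^ n" for n
  proof (rule power2_le_imp_le)
    show "(l2_norm (\<lambda>t. x n t - u t))\<^sup>2 \<le> (2 * (1/2) ^ n)\<^sup>2"
      using bound[of n] unfolding l2_norm_sq_nn[OF diff, symmetric] by (simp add: ennreal_le_iff)
  qed simp
  have "u \<in> L2" using L2_diff[OF x[of 0] diff[of 0]] by simp
  moreover have "(\<lambda>n. l2_norm (\<lambda>t. x n t - u t)) \<longlonglongrightarrow> 0"
  proof (rule tendsto_sandwich[of "\<lambda>_. 0" _ _ "\<lambda>n. 2 * (1/2) ^ n"])
    show "(\<lambda>n. 2 * (1/2::real) ^ n) \<longlonglongrightarrow> 0"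
      by (intro tendsto_mult_right_zero LIMSEQ_realpow_zero) auto
  qed (use le in auto)
  ultimately show ?thesis by blast
qed

text \<open>
  The net of finite partial sums is reduced to a sequence: along an increasing chain of finite sets
  \<open>G n\<close> such that any finite set disjoint from \<open>G n\<close> contributes at most \<open>(1/2) ^ n\<close>, the
  partial sums converge by the Riesz--Fischer theorem, and the same estimate carries the limit over to
  the whole net.
\<close>

lemma l2_has_sum_Cauchy:
  fixes x :: "'i \<Rightarrow> real \<Rightarrow> complex"
  assumes x: "\<And>i. x i \<in> L2"
    and Cauchy: "\<And>e. 0 < e \<Longrightarrow> \<exists>F0. finite F0 \<and>
      (\<forall>F. finite F \<and> F \<inter> F0 = {} \<longrightarrow> l2_norm (\<lambda>t. \<Sum>i\<in>F. x i t) \<le> e)"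
  shows "\<exists>u. l2_has_sum x u"
proof -
  have "\<forall>n::nat. \<exists>F0. finite F0 \<and>
      (\<forall>F. finite F \<and> F \<inter> F0 = {} \<longrightarrow> l2_norm (\<lambda>t. \<Sum>i\<in>F. x i t) \<le> (1/2) ^ n)"
    by (intro allI Cauchy) simp
  then obtain F0 where F0: "\<And>n::nat. finite (F0 n)"
    "\<And>n F. finite F \<Longrightarrow> F \<inter> F0 n = {} \<Longrightarrow> l2_norm (\<lambda>t. \<Sum>i\<in>F. x i t) \<le> (1/2) ^ n"
    by metis
  define G where "G n = (\<Union>k\<le>n. F0 k)" for n
  have G: "finite (G n)" "G n \<subseteq> G (Suc n)" "F0 n \<subseteq> G n" for n
    unfolding G_def using F0(1) by (auto simp: atMost_Suc)
  define y where "y n t = (\<Sum>i\<in>G n. x i t)" for n t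
  have y: "y n \<in> L2" for n unfolding y_def by (intro L2_sum x)
  have "l2_norm (\<lambda>t. y (Suc n) t - y n t) \<le> (1/2) ^ n" for n
  proof -
    have "y (Suc n) t - y n t = (\<Sum>i\<in>G (Suc n) - G n. x i t)" for t
      unfolding y_def using G by (simp add: sum_diff)
    moreover have "(G (Suc n) - G n) \<inter> F0 n = {}" using G(3)[of n] by blast
    ultimately show ?thesis using F0(2)[of "G (Suc n) - G n" n] G(1) by simp
  qed
  then obtain u where u: "u \<in> L2" "(\<lambda>n. l2_norm (\<lambda>t. y n t - u t)) \<longlonglongrightarrow> 0"
    using Riesz_Fischer[of y] y by blast
  have "((\<lambda>F. l2_norm (\<lambda>t. (\<Sum>i\<in>F. x i t) - u t)) \<longlongrightarrow> 0) (finite_subsets_at_top UNIV)"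
  proof (rule tendstoI)
    fix e :: real assume e: "0 < e"
    have "\<forall>\<^sub>F n in sequentially. l2_norm (\<lambda>t. y n t - u t) < e / 2"
      using order_tendstoD(2)[OF u(2), of "e/2"] e by simp
    moreover have "\<forall>\<^sub>F n in sequentially. (1/2::real) ^ n < e / 2"
      using order_tendstoD(2)[OF LIMSEQ_realpow_zero[of "1/2"], of "e/2"] e by simp
    ultimately have "\<forall>\<^sub>F n in sequentially. l2_norm (\<lambda>t. y n t - u t) < e / 2 \<and> (1/2::real) ^ n < e / 2"
      by (rule eventually_conj)
    then obtain n where n: "l2_norm (\<lambda>t. y n t - u t) < e / 2" "(1/2::real) ^ n < e / 2"
      by (auto simp: eventually_sequentially)
    have "l2_norm (\<lambda>t. (\<Sum>i\<in>F. x i t) - u t) < e" if F: "finite F" "G n \<subseteq> F" for F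
    proof -
      have eq: "(\<Sum>i\<in>F. x i t) - y n t = (\<Sum>i\<in>F - G n. x i t)" for t
        unfolding y_def using F by (simp add: sum_diff)
      have "l2_norm (\<lambda>t. (\<Sum>i\<in>F. x i t) - u t)
          \<le> l2_norm (\<lambda>t. (\<Sum>i\<in>F. x i t) - y n t) + l2_norm (\<lambda>t. y n t - u t)"
        by (rule l2_dist_triangle) (auto intro: L2_sum x y u)
      moreover have "l2_norm (\<lambda>t. (\<Sum>i\<in>F. x i t) - y n t) \<le> (1/2) ^ n"
        unfolding eq using F0(2)[of "F - G n" n] F(1) G(3)[of n] by blast
      ultimately show ?thesis using n by simp
    qed
    then show "\<forall>\<^sub>F F in finite_subsets_at_top UNIV.
        dist (l2_norm (\<lambda>t. (\<Sum>i\<in>F. x i t) - u t)) 0 < e"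
      unfolding eventually_finite_subsets_at_top using G(1)
      by (intro exI[of _ "G n"]) auto
  qed
  then show ?thesis unfolding l2_has_sum_def using x u(1) by blast
qed

lemma l2_has_sum_inner:
  assumes "l2_has_sum x u" "h \<in> L2"
  shows "((\<lambda>i. l2_inner (x i) h) has_sum l2_inner u h) UNIV"
proof -
  have x: "\<And>i. x i \<in> L2" and u: "u \<in> L2"
    and lim: "((\<lambda>F. l2_norm (\<lambda>t. (\<Sum>i\<in>F. x i t) - u t)) \<longlongrightarrow> 0) (finite_subsets_at_top UNIV)"
    using assms(1) by (auto simp: l2_has_sum_def)
  have "((\<lambda>F. (\<Sum>i\<in>F. l2_inner (x i) h) - l2_inner u h) \<longlongrightarrow> 0) (finite_subsets_at_top UNIV)"
  proof (rule Lim_null_comparison)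
    show "\<forall>\<^sub>F F in finite_subsets_at_top UNIV. norm ((\<Sum>i\<in>F. l2_inner (x i) h) - l2_inner u h)
        \<le> l2_norm (\<lambda>t. (\<Sum>i\<in>F. x i t) - u t) * l2_norm h"
    proof (intro always_eventually allI)
      fix F
      have "(\<Sum>i\<in>F. l2_inner (x i) h) - l2_inner u h = l2_inner (\<lambda>t. (\<Sum>i\<in>F. x i t) - u t) h"
        using x u assms(2) by (simp add: l2_inner_diff_left L2_sum l2_inner_sum_left)
      then show "norm ((\<Sum>i\<in>F. l2_inner (x i) h) - l2_inner u h)
          \<le> l2_norm (\<lambda>t. (\<Sum>i\<in>F. x i t) - u t) * l2_norm h"
        using l2_Cauchy_Schwarz[OF L2_diff[OF L2_sum[OF x] u] assms(2)] by simp
    qed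
    show "((\<lambda>F. l2_norm (\<lambda>t. (\<Sum>i\<in>F. x i t) - u t) * l2_norm h) \<longlongrightarrow> 0) (finite_subsets_at_top UNIV)"
      using tendsto_mult_left_zero[OF lim] .
  qed
  then show ?thesis unfolding has_sum_def using LIM_zero_cancel by blast
qed

lemma l2_has_sum_scale:
  assumes "l2_has_sum x u" shows "l2_has_sum (\<lambda>i t. c * x i t) (\<lambda>t. c * u t)"
proof -
  have "(\<Sum>i\<in>F. c * x i t) - c * u t = c * ((\<Sum>i\<in>F. x i t) - u t)" for F t
    by (simp add: sum_distrib_left right_diff_distrib)
  then show ?thesis
    using assms tendsto_mult_right_zero[of "\<lambda>F. l2_norm (\<lambda>t. (\<Sum>i\<in>F. x i t) - u t)" _ "cmod c"]
    by (simp add: l2_has_sum_def L2_scale l2_norm_scale)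
qed

lemma l2_has_sum_imp_weak: "l2_has_sum x u \<Longrightarrow> l2_has_weak_sum x u"
  unfolding l2_has_weak_sum_def using l2_has_sum_inner by (auto simp: l2_has_sum_def)

lemma nonneg_summable_tail:
  fixes c :: "'i \<Rightarrow> real"
  assumes "c summable_on UNIV" "\<And>i. 0 \<le> c i" "0 < e"
  shows "\<exists>F0. finite F0 \<and> (\<forall>F. finite F \<and> F \<inter> F0 = {} \<longrightarrow> sum c F \<le> e)"
proof -
  have "(sum c \<longlongrightarrow> infsum c UNIV) (finite_subsets_at_top UNIV)"
    using has_sum_infsum[OF assms(1)] by (simp add: has_sum_def)
  from order_tendstoD(1)[OF this, of "infsum c UNIV - e"] assms(3)
  obtain F0 where F0: "finite F0" "sum c F0 > infsum c UNIV - e"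
    unfolding eventually_finite_subsets_at_top by (auto dest: spec[of _ "_ :: 'i set"])
  show ?thesis
  proof (intro exI conjI allI impI)
    fix F assume F: "finite F \<and> F \<inter> F0 = {}"
    have "sum c (F \<union> F0) \<le> infsum c UNIV"
      using assms F F0 by (intro finite_sum_le_infsum) auto
    moreover have "sum c (F \<union> F0) = sum c F + sum c F0"
      using F F0 by (intro sum.union_disjoint) auto
    ultimately show "sum c F \<le> e" using F0(2) by simp
  qed (rule F0)
qed

text \<open>
  By duality: pairing a finite sum \<open>v = \<Sum> c\<^sub>p e\<^sub>p\<close> with itself and applying the Bessel bound to \<open>v\<close>
  gives \<open>\<parallel>v\<parallel>\<^sup>2 \<le> B \<Sum> |c\<^sub>p|\<^sup>2\<close>, so the tails of \<open>c\<close> control those of the series. This provides both the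
  frame operator and the Fourier expansion on a window.
\<close>

lemma Bessel_synthesis:
  fixes e :: "'i \<Rightarrow> real \<Rightarrow> complex"
  assumes e: "\<And>p. e p \<in> L2"
    and Bessel: "\<And>f F. f \<in> L2 \<Longrightarrow> finite F \<Longrightarrow> (\<Sum>p\<in>F. (cmod (l2_inner f (e p)))\<^sup>2) \<le> B * (l2_norm f)\<^sup>2"
    and c: "(\<lambda>p. (cmod (c p))\<^sup>2) summable_on UNIV"
  shows "\<exists>u. l2_has_sum (\<lambda>p t. c p * e p t) u"
proof (rule l2_has_sum_Cauchy)
  show ce: "(\<lambda>t. c p * e p t) \<in> L2" for p by (rule L2_scale[OF e])
  have synth: "(l2_norm (\<lambda>t. \<Sum>p\<in>F. c p * e p t))\<^sup>2 \<le> \<bar>B\<bar> * (\<Sum>p\<in>F. (cmod (c p))\<^sup>2)"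
    if F: "finite F" for F
  proof -
    define v where "v t = (\<Sum>p\<in>F. c p * e p t)" for t
    have v: "v \<in> L2" unfolding v_def by (intro L2_sum ce)
    have v_eq: "v = (\<lambda>t. \<Sum>p\<in>F. c p * e p t)" by (simp add: v_def fun_eq_iff)
    have "(l2_norm v)\<^sup>2 = cmod (l2_inner v v)"
      by (simp add: l2_inner_self norm_power)
    also have "l2_inner v v = (\<Sum>p\<in>F. c p * l2_inner (e p) v)"
      using arg_cong[OF v_eq, of "\<lambda>w. l2_inner w v"]
      by (simp add: l2_inner_sum_left[OF ce v] l2_inner_scale_left)
    also have "cmod \<dots> \<le> (\<Sum>p\<in>F. cmod (c p) * cmod (l2_inner v (e p)))"
      using norm_sum[of "\<lambda>p. c p * l2_inner (e p) v" F]
      by (simp add: norm_mult l2_inner_cnj[of _ v])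
    finally have "((l2_norm v)\<^sup>2)\<^sup>2 \<le> (\<Sum>p\<in>F. cmod (c p) * cmod (l2_inner v (e p)))\<^sup>2"
      by (intro power_mono) auto
    also have "\<dots> \<le> (\<Sum>p\<in>F. (cmod (c p))\<^sup>2) * (\<Sum>p\<in>F. (cmod (l2_inner v (e p)))\<^sup>2)"
      by (rule Cauchy_Schwarz_ineq_sum)
    also have "\<dots> \<le> (\<Sum>p\<in>F. (cmod (c p))\<^sup>2) * (\<bar>B\<bar> * (l2_norm v)\<^sup>2)"
    proof (rule mult_left_mono)
      have "B * (l2_norm v)\<^sup>2 \<le> \<bar>B\<bar> * (l2_norm v)\<^sup>2"
        by (rule mult_right_mono) auto
      then show "(\<Sum>p\<in>F. (cmod (l2_inner v (e p)))\<^sup>2) \<le> \<bar>B\<bar> * (l2_norm v)\<^sup>2"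
        using Bessel[OF v F] by simp
    qed (simp add: sum_nonneg)
    finally have "(l2_norm v)\<^sup>2 * (l2_norm v)\<^sup>2
        \<le> (\<bar>B\<bar> * (\<Sum>p\<in>F. (cmod (c p))\<^sup>2)) * (l2_norm v)\<^sup>2"
      by (simp add: power2_eq_square mult_ac)
    moreover have "0 \<le> \<bar>B\<bar> * (\<Sum>p\<in>F. (cmod (c p))\<^sup>2)"
      by (intro mult_nonneg_nonneg sum_nonneg) auto
    ultimately have "(l2_norm v)\<^sup>2 \<le> \<bar>B\<bar> * (\<Sum>p\<in>F. (cmod (c p))\<^sup>2)"
      using mult_right_le_imp_le[of "(l2_norm v)\<^sup>2" "(l2_norm v)\<^sup>2"]
      by (cases "(l2_norm v)\<^sup>2 = 0") (auto simp del: mult_le_cancel_right)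
    then show ?thesis by (simp add: v_eq)
  qed
  show "\<exists>F0. finite F0 \<and>
      (\<forall>F. finite F \<and> F \<inter> F0 = {} \<longrightarrow> l2_norm (\<lambda>t. \<Sum>p\<in>F. c p * e p t) \<le> \<epsilon>)" if "0 < \<epsilon>" for \<epsilon>
  proof -
    have pos: "0 < \<epsilon>\<^sup>2 / (\<bar>B\<bar> + 1)" using that by (intro divide_pos_pos) auto
    obtain F0 where F0: "finite F0"
      "\<And>F. finite F \<Longrightarrow> F \<inter> F0 = {} \<Longrightarrow> (\<Sum>p\<in>F. (cmod (c p))\<^sup>2) \<le> \<epsilon>\<^sup>2 / (\<bar>B\<bar> + 1)"
      using nonneg_summable_tail[OF c _ pos] by auto
    have "l2_norm (\<lambda>t. \<Sum>p\<in>F. c p * e p t) \<le> \<epsilon>" if F: "finite F" "F \<inter> F0 = {}" for F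
    proof (rule power2_le_imp_le)
      have "(l2_norm (\<lambda>t. \<Sum>p\<in>F. c p * e p t))\<^sup>2 \<le> \<bar>B\<bar> * (\<epsilon>\<^sup>2 / (\<bar>B\<bar> + 1))"
        using order_trans[OF synth[OF F(1)] mult_left_mono[OF F0(2)[OF F] abs_ge_zero[of B]]] .
      also have "\<dots> \<le> \<epsilon>\<^sup>2"
        by (simp add: field_simps)
      finally show "(l2_norm (\<lambda>t. \<Sum>p\<in>F. c p * e p t))\<^sup>2 \<le> \<epsilon>\<^sup>2" .
    qed (use \<open>0 < \<epsilon>\<close> in simp)
    with F0(1) show ?thesis by blast
  qed
qed

text \<open>
  Stated for sublinear functionals, so that it applies to \<open>h \<mapsto> |\<langle>S\<^sub>M f, h\<rangle>|\<close> as well as to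
  \<open>f \<mapsto> \<parallel>S\<^sub>M f\<parallel>\<close>. The proof is Sokal's: if the norms \<open>N i\<close> are unbounded, choose \<open>i n\<close> with
  \<open>N (i n) > 4 ^ n\<close> and move from \<open>x n\<close> by a vector of length at most \<open>(1/3) ^ n\<close> to a point where
  \<open>p (i n)\<close> is at least \<open>3/4 * N (i n) / 3 ^ n\<close>. The later steps add up to at most half of \<open>(1/3) ^ n\<close>
  and so cannot undo this: at the limit point \<open>p (i n)\<close> is at least \<open>(4/3) ^ n / 4\<close>.
\<close>

theorem uniform_boundedness:
  fixes p :: "'i \<Rightarrow> (real \<Rightarrow> complex) \<Rightarrow> real"
  assumes add: "\<And>i f h. f \<in> L2 \<Longrightarrow> h \<in> L2 \<Longrightarrow> p i (\<lambda>t. f t + h t) \<le> p i f + p i h"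
    and scale: "\<And>i f r. f \<in> L2 \<Longrightarrow> p i (\<lambda>t. complex_of_real r * f t) = \<bar>r\<bar> * p i f"
    and bounded: "\<And>i. \<exists>C. \<forall>f\<in>L2. p i f \<le> C * l2_norm f"
    and pointwise: "\<And>f. f \<in> L2 \<Longrightarrow> \<exists>K. \<forall>i. p i f \<le> K"
  shows "\<exists>K\<ge>0. \<forall>i. \<forall>f\<in>L2. p i f \<le> K * l2_norm f"
proof -
  have neg: "p i (\<lambda>t. - f t) = p i f" if "f \<in> L2" for i f
    using scale[OF that, of i "-1"] by simp
  have p0: "p i (\<lambda>t. 0) = 0" for i
    using scale[OF L2_zero, of i 0] by simp
  have nonneg: "0 \<le> p i f" if "f \<in> L2" for i f
    using add[OF that L2_uminus[OF that], of i] neg[OF that, of i] p0[of i] by simp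
  define N where "N i = (SUP f\<in>{f\<in>L2. l2_norm f \<le> 1}. p i f)" for i
  have ball0: "(\<lambda>t. 0) \<in> {f\<in>L2. l2_norm f \<le> 1}" by (simp add: L2_zero)
  have bdd: "bdd_above (p i ` {f\<in>L2. l2_norm f \<le> 1})" for i
  proof -
    obtain C where C: "\<forall>f\<in>L2. p i f \<le> C * l2_norm f" using bounded by blast
    show ?thesis
    proof (rule bdd_aboveI2[of _ _ "\<bar>C\<bar>"])
      fix f assume f: "f \<in> {f\<in>L2. l2_norm f \<le> 1}"
      then have "p i f \<le> C * l2_norm f" using C by auto
      also have "\<dots> \<le> \<bar>C\<bar> * l2_norm f" by (rule mult_right_mono) auto
      also have "\<dots> \<le> \<bar>C\<bar> * 1" using f by (intro mult_left_mono) auto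
      finally show "p i f \<le> \<bar>C\<bar>" by simp
    qed
  qed
  have N_bound: "p i f \<le> N i * l2_norm f" if f: "f \<in> L2" for i f
  proof (cases "l2_norm f = 0")
    case True
    obtain C where "\<forall>f\<in>L2. p i f \<le> C * l2_norm f" using bounded by blast
    with True f show ?thesis by fastforce
  next
    case False
    then have pos: "0 < l2_norm f" using l2_norm_nonneg[of f] by linarith
    have "l2_norm (\<lambda>t. complex_of_real (1 / l2_norm f) * f t) \<le> 1"
      using pos unfolding l2_norm_scale by (simp add: norm_divide)
    then have "p i (\<lambda>t. complex_of_real (1 / l2_norm f) * f t) \<le> N i"
      unfolding N_def using L2_scale[OF f] by (intro cSUP_upper bdd) blast
    then show ?thesis using pos unfolding scale[OF f] by (simp add: field_simps)
  qed
  show ?thesis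
  proof (rule ccontr)
    assume contra: "\<not> ?thesis"
    have "\<exists>i. N i > 4 ^ n" for n :: nat
    proof (rule ccontr)
      assume "\<not> ?thesis"
      then have "N i \<le> 4 ^ n" for i by (simp add: not_less)
      then have "p i f \<le> 4 ^ n * l2_norm f" if "f \<in> L2" for i f
        using N_bound[OF that, of i] by (meson mult_right_mono l2_norm_nonneg order_trans)
      then have "0 \<le> (4::real) ^ n \<and> (\<forall>i. \<forall>f\<in>L2. p i f \<le> 4 ^ n * l2_norm f)" by simp
      with contra show False by blast
    qed
    then obtain i where i: "\<And>n::nat. N (i n) > 4 ^ n" by metis
    have N_pos: "0 < N (i n)" for n
      using i[of n] by (meson less_trans zero_less_numeral zero_less_power)
    have "\<exists>y\<in>{f\<in>L2. l2_norm f \<le> 1}. 3 / 4 * N (i n) < p (i n) y" for n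
    proof -
      have "3 / 4 * N (i n) < (SUP f\<in>{f\<in>L2. l2_norm f \<le> 1}. p (i n) f)"
        using N_pos[of n] by (simp add: N_def)
      then show ?thesis
        by (subst (asm) less_cSUP_iff) (use ball0 bdd in auto)
    qed
    then obtain y where y: "\<And>n. y n \<in> L2" "\<And>n. l2_norm (y n) \<le> 1"
        "\<And>n. 3 / 4 * N (i n) < p (i n) (y n)"
      by (metis (mono_tags, lifting) mem_Collect_eq)
    (* Of the two points x + z and x - z one has a value at least that of z: this is where
       sublinearity replaces the Baire category theorem. *)
    have "\<exists>x'. x' \<in> L2 \<and> (l2_norm (\<lambda>t. x' t - x t) \<le> (1/3) ^ n
        \<and> (1/3) ^ n * (3 / 4 * N (i n)) \<le> p (i n) x')" if x: "x \<in> L2" for x n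
    proof -
      define z where "z t = complex_of_real ((1/3) ^ n) * y n t" for t
      have z: "z \<in> L2" unfolding z_def by (intro L2_scale y)
      have nz: "l2_norm z \<le> (1/3) ^ n"
        using y(2)[of n] mult_left_mono[OF y(2)[of n], of "(1/3) ^ n"]
        unfolding z_def l2_norm_scale by (simp add: norm_power norm_divide)
      have pz: "(1/3) ^ n * (3 / 4 * N (i n)) \<le> p (i n) z"
        unfolding z_def scale[OF y(1)] using y(3)[of n]
        by (simp add: mult_left_mono less_imp_le)
      have "p (i n) (\<lambda>t. 2 * z t) \<le> p (i n) (\<lambda>t. x t + z t) + p (i n) (\<lambda>t. - (x t - z t))"
        using add[OF L2_add[OF x z] L2_uminus[OF L2_diff[OF x z]], of "i n"] by simp
      then have "2 * p (i n) z \<le> p (i n) (\<lambda>t. x t + z t) + p (i n) (\<lambda>t. x t - z t)"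
        using scale[OF z, of "i n" 2] neg[OF L2_diff[OF x z], of "i n"] by simp
      then consider "p (i n) z \<le> p (i n) (\<lambda>t. x t + z t)" | "p (i n) z \<le> p (i n) (\<lambda>t. x t - z t)"
        by linarith
      then show ?thesis
      proof cases
        case 1
        then show ?thesis using pz nz L2_add[OF x z]
          by (intro exI[of _ "\<lambda>t. x t + z t"]) auto
      next
        case 2
        then show ?thesis using pz nz L2_diff[OF x z] l2_norm_scale[of "-1" z]
          by (intro exI[of _ "\<lambda>t. x t - z t"]) auto
      qed
    qed
    then have "\<exists>x. \<forall>n. x n \<in> L2 \<and> (l2_norm (\<lambda>t. x (Suc n) t - x n t) \<le> (1/3) ^ n
        \<and> (1/3) ^ n * (3 / 4 * N (i n)) \<le> p (i n) (x (Suc n)))"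
      by (intro dependent_nat_choice[where P = "\<lambda>_ x. x \<in> L2"]) (use L2_zero in blast)+
    then obtain x where x: "\<And>n. x n \<in> L2"
      and x_step: "\<And>n. l2_norm (\<lambda>t. x (Suc n) t - x n t) \<le> (1/3) ^ n"
      and x_large: "\<And>n. (1/3) ^ n * (3 / 4 * N (i n)) \<le> p (i n) (x (Suc n))"
      by blast
    have "l2_norm (\<lambda>t. x (Suc n) t - x n t) \<le> (1/2) ^ n" for n
      using x_step[of n] power_mono[of "1/3::real" "1/2" n] by simp
    then obtain u where u: "u \<in> L2" "(\<lambda>n. l2_norm (\<lambda>t. x n t - u t)) \<longlonglongrightarrow> 0"
      using Riesz_Fischer[of x] x by blast
    have dist: "l2_norm (\<lambda>t. x (Suc n) t - u t) \<le> (1/3) ^ n / 2" for n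
    proof (rule LIMSEQ_le_const)
      show "(\<lambda>k. (1/3) ^ n / 2 + l2_norm (\<lambda>t. x (k + Suc n) t - u t)) \<longlonglongrightarrow> (1/3) ^ n / 2"
        using tendsto_add[OF tendsto_const LIMSEQ_ignore_initial_segment[OF u(2), of "Suc n"],
            of "(1/3) ^ n / 2"] by simp
      show "\<exists>K. \<forall>k\<ge>K. l2_norm (\<lambda>t. x (Suc n) t - u t)
          \<le> (1/3) ^ n / 2 + l2_norm (\<lambda>t. x (k + Suc n) t - u t)"
      proof (intro exI[of _ 0] allI impI)
        fix k
        have "l2_norm (\<lambda>t. x (Suc n) t - u t) \<le> l2_norm (\<lambda>t. x (Suc n) t - x (k + Suc n) t)
            + l2_norm (\<lambda>t. x (k + Suc n) t - u t)"
          by (rule l2_dist_triangle[OF x x u(1)])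
        also have "l2_norm (\<lambda>t. x (Suc n) t - x (k + Suc n) t) \<le> (1/3) ^ Suc n / (1 - 1/3)"
          using l2_norm_telescope[OF x x_step, of "Suc n" k]
          by (subst l2_norm_minus_commute) (simp add: add.commute)
        finally show "l2_norm (\<lambda>t. x (Suc n) t - u t)
          \<le> (1/3) ^ n / 2 + l2_norm (\<lambda>t. x (k + Suc n) t - u t)" by simp
      qed
    qed
    obtain K where K: "\<And>j. p j u \<le> K" using pointwise[OF u(1)] by blast
    have "(4/3) ^ n \<le> 4 * K" for n
    proof -
      have "(1/3) ^ n * (3 / 4 * N (i n)) \<le> p (i n) (x (Suc n))" by (rule x_large)
      also have "\<dots> \<le> p (i n) (\<lambda>t. x (Suc n) t - u t) + p (i n) u"
        using add[OF L2_diff[OF x u(1)] u(1), of "i n" "Suc n"] by simp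
      also have "p (i n) (\<lambda>t. x (Suc n) t - u t) \<le> N (i n) * ((1/3) ^ n / 2)"
        using N_bound[OF L2_diff[OF x[of "Suc n"] u(1)], of "i n"] N_pos[of n]
          mult_left_mono[OF dist[of n], of "N (i n)"] by linarith
      finally have "(1/3) ^ n * N (i n) \<le> 4 * K" using K[of "i n"] by (simp add: mult.commute)
      moreover have "(1/3) ^ n * 4 ^ n \<le> (1/3) ^ n * N (i n)"
        using i[of n] by (intro mult_left_mono) auto
      ultimately show ?thesis by (simp add: power_mult_distrib[symmetric])
    qed
    moreover obtain n where "(4/3::real) ^ n > 4 * K"
      using real_arch_pow[of "4/3" "4 * K"] by auto
    ultimately show False by (meson not_less)
  qed
qed

section \<open>Fourier series on an interval\<close>

definition character :: "real \<Rightarrow> int \<Rightarrow> real \<Rightarrow> complex" where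
  "character b m t = cis (2 * pi * of_int m * b * t)"

lemma character_measurable [measurable]: "character b m \<in> borel_measurable borel"
  unfolding character_def cis_conv_exp by (intro borel_measurable_continuous_onI continuous_intros)

lemma cnj_measurable [measurable]: "cnj \<in> borel_measurable borel"
  by (intro borel_measurable_continuous_onI continuous_intros)

lemma norm_character [simp]: "cmod (character b m t) = 1"
  by (simp add: character_def)

lemma character_0 [simp]: "character b 0 t = 1"
  by (simp add: character_def)

lemma character_mult: "character b m t * character b n t = character b (m + n) t"
  by (simp add: character_def cis_mult algebra_simps)

lemma cnj_character: "cnj (character b m t) = character b (- m) t"
  by (simp add: character_def cis_cnj)

lemma character_periodic:
  assumes "b \<noteq> 0" shows "character b m (t + of_int j / b) = character b m t"
proof -
  have "character b m (t + of_int j / b) = character b m t * cis (2 * pi * of_int (m * j))"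
    using assms by (simp add: character_def cis_mult distrib_left mult_ac add.commute)
  also have "cis (2 * pi * of_int (m * j)) = 1"
    by (rule cis_multiple_2pi) simp
  finally show ?thesis by simp
qed

lemma integrable_bounded_mult:
  fixes h :: "real \<Rightarrow> complex"
  assumes "integrable lborel h" "\<phi> \<in> borel_measurable borel" "\<And>t. cmod (\<phi> t) \<le> C"
  shows "integrable lborel (\<lambda>t. h t * \<phi> t)"
proof (rule Bochner_Integration.integrable_bound)
  show "integrable lborel (\<lambda>t. of_real C * h t)" using assms by simp
  have "norm (h t * \<phi> t) \<le> norm (of_real C * h t)" for t
    using mult_right_mono[OF assms(3)[of t], of "cmod (h t)"]
      mult_right_mono[OF abs_ge_self[of C], of "cmod (h t)"]
    by (simp add: norm_mult mult.commute)
  then show "AE t in lborel. norm (h t * \<phi> t) \<le> norm (of_real C * h t)" by simp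
  have [measurable]: "h \<in> borel_measurable borel"
    using borel_measurable_integrable[OF assms(1)] by simp
  show "(\<lambda>t. h t * \<phi> t) \<in> borel_measurable lborel" using assms(2) by simp
qed

text \<open>
  Integrability is what multiplication by bounded functions preserves, and integrable functions
  suffice for the uniqueness theorem.
\<close>

definition fourier_null :: "real \<Rightarrow> (real \<Rightarrow> complex) \<Rightarrow> bool" where
  "fourier_null b h \<longleftrightarrow> integrable lborel h \<and>
     (\<forall>m. (LINT t|lborel. h t * cnj (character b m t)) = 0)"

text \<open>
  A real linear form in \<open>z\<close> is a combination of \<open>z\<close> and its conjugate; multiplying by these shifts
  the index of the Fourier coefficients by one, which keeps them all zero. Products of polynomials are
  covered because the claim is made for all \<open>h\<close> at once.
\<close>

lemma fourier_null_polynomial: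
  assumes "real_polynomial_function q" "fourier_null b h"
  shows "fourier_null b (\<lambda>t. h t * complex_of_real (q (character b 1 t)))"
  using assms
proof (induction arbitrary: h)
  case (linear q)
  have int: "integrable lborel (\<lambda>t. h t * cnj (character b m t))" for m
    using linear.prems by (intro integrable_bounded_mult[where C = 1]) (auto simp: fourier_null_def)
  define \<alpha> where "\<alpha> = (complex_of_real (q 1) - \<i> * complex_of_real (q \<i>)) / 2"
  define \<beta> where "\<beta> = (complex_of_real (q 1) + \<i> * complex_of_real (q \<i>)) / 2"
  have q: "complex_of_real (q z) = \<alpha> * z + \<beta> * cnj z" for z
  proof -
    have "q z = q (Re z *\<^sub>R 1 + Im z *\<^sub>R \<i>)"
      by (rule arg_cong[of _ _ q]) (simp add: complex_eq_iff)
    also have "\<dots> = Re z * q 1 + Im z * q \<i>"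
      using linear.hyps by (simp add: linear_add linear_scale bounded_linear.linear)
    finally show ?thesis by (simp add: \<alpha>_def \<beta>_def complex_eq_iff field_simps)
  qed
  have eq: "h t * complex_of_real (q (character b 1 t)) * cnj (character b m t)
      = \<alpha> * (h t * cnj (character b (m - 1) t)) + \<beta> * (h t * cnj (character b (m + 1) t))" for t m
    unfolding q cnj_character
    using character_mult[of b 1 t "-m"] character_mult[of b "-1" t "-m"]
    by (simp add: distrib_left distrib_right mult_ac minus_diff_commute)
  have "integrable lborel (\<lambda>t. h t * complex_of_real (q (character b 1 t)))"
    using Bochner_Integration.integrable_add[OF integrable_mult_right[OF int[of "-1"], of \<alpha>]
        integrable_mult_right[OF int[of 1], of \<beta>]] eq[of _ 0] by simp
  then show ?case
    unfolding fourier_null_def eq using int linear.prems by (auto simp: fourier_null_def)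
next
  case (const c)
  then show ?case by (auto simp: fourier_null_def mult.assoc mult.left_commute mult.commute[of _ "complex_of_real c"])
next
  case (add p q)
  have int: "integrable lborel (\<lambda>t. h t * complex_of_real (r (character b 1 t)) * cnj (character b m t))"
    if "fourier_null b (\<lambda>t. h t * complex_of_real (r (character b 1 t)))" for r m
    using that by (intro integrable_bounded_mult[where C = 1 and
          h = "\<lambda>t. h t * complex_of_real (r (character b 1 t))"]) (auto simp: fourier_null_def)
  show ?case
    using add.IH[OF add.prems] int[of p, OF add.IH(1)[OF add.prems]] int[of q, OF add.IH(2)[OF add.prems]]
    by (auto simp: fourier_null_def distrib_left distrib_right)
next
  case (mult p q)
  show ?case using mult.IH(2)[OF mult.IH(1)[OF mult.prems]] by (simp add: mult.assoc)
qed

text \<open>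
  By the Stone--Weierstrass theorem on the unit circle.
\<close>

lemma fourier_null_continuous:
  assumes h: "fourier_null b h" and \<phi>: "continuous_on UNIV \<phi>"
  shows "(LINT t|lborel. h t * complex_of_real (\<phi> (character b 1 t))) = 0"
proof -
  have h_int: "integrable lborel h" using h by (simp add: fourier_null_def)
  have [measurable]: "\<phi> \<in> borel_measurable borel"
    by (rule borel_measurable_continuous_onI[OF \<phi>])
  have "compact (sphere (0::complex) 1)" by simp
  then have "compact (\<phi> ` sphere 0 1)"
    using \<phi> by (intro compact_continuous_image) (auto intro: continuous_on_subset)
  then obtain C where C: "\<And>z. z \<in> sphere 0 1 \<Longrightarrow> \<bar>\<phi> z\<bar> \<le> C"
    using compact_imp_bounded[of "\<phi> ` sphere 0 1"] unfolding bounded_iff real_norm_def by (metis image_eqI)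
  have int: "integrable lborel (\<lambda>t. h t * complex_of_real (\<phi> (character b 1 t)))"
    by (rule integrable_bounded_mult[OF h_int, where C = C]) (auto intro: C)
  define I where "I = (LINT t|lborel. cmod (h t))"
  have "cmod (LINT t|lborel. h t * complex_of_real (\<phi> (character b 1 t))) \<le> e * I" if e: "0 < e" for e
  proof -
    obtain q where q: "real_polynomial_function q" "\<And>z. z \<in> sphere 0 1 \<Longrightarrow> \<bar>\<phi> z - q z\<bar> < e"
      using Stone_Weierstrass_real_polynomial_function[of "sphere 0 1" \<phi> e] e \<phi>
      by (auto intro: continuous_on_subset)
    have null: "fourier_null b (\<lambda>t. h t * complex_of_real (q (character b 1 t)))"
      by (rule fourier_null_polynomial[OF q(1) h])
    have "(LINT t|lborel. h t * complex_of_real (q (character b 1 t)))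
        = (LINT t|lborel. h t * complex_of_real (q (character b 1 t)) * cnj (character b 0 t))" by simp
    also have "\<dots> = 0" using null unfolding fourier_null_def by blast
    finally have zero: "(LINT t|lborel. h t * complex_of_real (q (character b 1 t))) = 0" .
    have int_q: "integrable lborel (\<lambda>t. h t * complex_of_real (q (character b 1 t)))"
      using null by (simp add: fourier_null_def)
    have "(LINT t|lborel. h t * complex_of_real (\<phi> (character b 1 t)))
        = (LINT t|lborel. h t * complex_of_real (\<phi> (character b 1 t)) - h t * complex_of_real (q (character b 1 t)))"
      using Bochner_Integration.integral_diff[OF int int_q] zero by simp
    also have "cmod \<dots> \<le> (LINT t|lborel. cmod (h t * complex_of_real (\<phi> (character b 1 t)) - h t * complex_of_real (q (character b 1 t))))"
      by (rule integral_norm_bound)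
    also have "\<dots> \<le> (LINT t|lborel. e * cmod (h t))"
    proof (rule integral_mono)
      fix t
      have "\<bar>\<phi> (character b 1 t) - q (character b 1 t)\<bar> \<le> e"
        using q(2)[of "character b 1 t"] by simp
      then have "cmod (complex_of_real (\<phi> (character b 1 t) - q (character b 1 t))) \<le> e"
        unfolding norm_of_real .
      then have "cmod (h t) * cmod (complex_of_real (\<phi> (character b 1 t) - q (character b 1 t))) \<le> cmod (h t) * e"
        by (rule mult_left_mono) simp
      then show "cmod (h t * complex_of_real (\<phi> (character b 1 t)) - h t * complex_of_real (q (character b 1 t))) \<le> e * cmod (h t)"
        unfolding norm_mult[symmetric] by (simp add: right_diff_distrib mult.commute)
    qed (use int int_q h_int in auto)
    finally show ?thesis by (simp add: I_def)
  qed
  note le = this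
  have I: "0 \<le> I" unfolding I_def by simp
  have "cmod (LINT t|lborel. h t * complex_of_real (\<phi> (character b 1 t))) \<le> 0 + e" if "0 < e" for e
  proof -
    have "cmod (LINT t|lborel. h t * complex_of_real (\<phi> (character b 1 t))) \<le> e / (I + 1) * I"
      using that I by (intro le) auto
    also have "\<dots> \<le> e" using that I by (simp add: field_simps)
    finally show ?thesis by simp
  qed
  then have "cmod (LINT t|lborel. h t * complex_of_real (\<phi> (character b 1 t))) \<le> 0"
    by (rule field_le_epsilon)
  then show ?thesis by simp
qed

text \<open>
  The indicator of \<open>K\<close> is the pointwise limit of the continuous functions
  \<open>max 0 (1 - n * infdist z K)\<close>.
\<close>

lemma fourier_null_closed:
  assumes h: "fourier_null b h" and K: "closed K"
  shows "(LINT t|lborel. h t * indicator K (character b 1 t)) = 0"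
proof (cases "K = {}")
  case False
  define \<phi> where "\<phi> n z = max 0 (1 - real n * infdist z K)" for n :: nat and z :: complex
  have \<phi>: "continuous_on UNIV (\<phi> n)" for n
    unfolding \<phi>_def by (intro continuous_intros)
  have [measurable]: "\<phi> n \<in> borel_measurable borel" for n
    by (rule borel_measurable_continuous_onI[OF \<phi>])
  have [measurable]: "K \<in> sets borel" using K by simp
  have h_int: "integrable lborel h" using h by (simp add: fourier_null_def)
  then have [measurable]: "h \<in> borel_measurable borel"
    using borel_measurable_integrable by force
  have lim: "(\<lambda>n. \<phi> n z) \<longlonglongrightarrow> indicator K z" for z
  proof (cases "z \<in> K")
    case True
    then show ?thesis by (simp add: \<phi>_def)
  next
    case False
    then have pos: "0 < infdist z K"
      using in_closed_iff_infdist_zero[OF K \<open>K \<noteq> {}\<close>] infdist_nonneg[of z K] by force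
    obtain N where N: "1 < real N * infdist z K" using reals_Archimedean3[OF pos] by blast
    have "\<forall>\<^sub>F n in sequentially. \<phi> n z = 0"
      using eventually_ge_at_top[of N]
    proof eventually_elim
      case (elim n)
      then have "real N * infdist z K \<le> real n * infdist z K"
        using pos by (intro mult_right_mono) auto
      then show ?case using N by (simp add: \<phi>_def)
    qed
    then show ?thesis using False by (simp add: tendsto_eventually)
  qed
  have "(\<lambda>n. LINT t|lborel. h t * complex_of_real (\<phi> n (character b 1 t)))
      \<longlonglongrightarrow> (LINT t|lborel. h t * indicator K (character b 1 t))"
  proof (rule integral_dominated_convergence[where w = "\<lambda>t. cmod (h t)"])
    have "(\<lambda>n. complex_of_real (\<phi> n z)) \<longlonglongrightarrow> indicator K z" for z
      using tendsto_of_real[OF lim[of z], where 'a = complex] by (cases "z \<in> K") auto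
    then show "AE t in lborel. (\<lambda>n. h t * complex_of_real (\<phi> n (character b 1 t)))
        \<longlonglongrightarrow> h t * indicator K (character b 1 t)"
      by (intro AE_I2 tendsto_mult tendsto_const) auto
    have "\<bar>\<phi> n z\<bar> \<le> 1" for n z by (simp add: \<phi>_def infdist_nonneg)
    then show "AE t in lborel. norm (h t * complex_of_real (\<phi> n (character b 1 t))) \<le> cmod (h t)" for n
      by (intro AE_I2) (simp add: norm_mult mult_left_le)
  qed (use h_int in auto)
  then show ?thesis
    unfolding fourier_null_continuous[OF h \<phi>] by (simp add: LIMSEQ_const_iff)
qed simp

text \<open>
  Half-open, so that the windows partition the line.
\<close>

definition window :: "real \<Rightarrow> int \<Rightarrow> real set" where
  "window b j = {of_int j / b ..< (of_int j + 1) / b}"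

lemma window_borel [measurable]: "window b j \<in> sets borel"
  by (simp add: window_def)

lemma character_inj_on_window:
  assumes "0 < b" shows "inj_on (character b 1) (window b 0)"
proof (rule inj_onI)
  fix s t assume st: "s \<in> window b 0" "t \<in> window b 0" "character b 1 s = character b 1 t"
  then have "\<bar>2 * pi * b * s - 2 * pi * b * t\<bar> < 2 * pi"
  proof -
    have "0 \<le> b * s" "b * s < 1" "0 \<le> b * t" "b * t < 1"
      using st assms by (auto simp: window_def field_simps)
    then have "\<bar>b * s - b * t\<bar> < 1" by linarith
    then have "2 * pi * \<bar>b * s - b * t\<bar> < 2 * pi * 1"
      by (intro mult_strict_left_mono) auto
    moreover have "\<bar>2 * pi * b * s - 2 * pi * b * t\<bar> = 2 * pi * \<bar>b * s - b * t\<bar>"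
      by (simp add: abs_mult flip: right_diff_distrib mult.assoc)
    ultimately show ?thesis by simp
  qed
  moreover have "sin (2 * pi * b * s) = sin (2 * pi * b * t) \<and> cos (2 * pi * b * s) = cos (2 * pi * b * t)"
    using st(3) by (simp add: character_def complex_eq_iff)
  then obtain n where "2 * pi * b * s = 2 * pi * b * t + 2 * pi * of_int n"
    unfolding sin_cos_eq_iff by auto
  ultimately have n: "2 * pi * b * s = 2 * pi * b * t + 2 * pi * of_int n" "\<bar>2 * pi * of_int n\<bar> < 2 * pi"
    by auto
  then have "\<bar>real_of_int n\<bar> < 1" by (simp add: abs_mult)
  then have "n = 0" by linarith
  with n(1) assms show "s = t" by simp
qed

text \<open>
  Since \<open>character b 1\<close> is injective on the half-open window, a compact subset \<open>D\<close> of the window is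
  cut out by the condition that \<open>character b 1 t\<close> lies in the closed set \<open>character b 1 ` D\<close>. Hence
  \<open>h\<close> has integral 0 over \<open>D\<close>, then over all closed sets, and by Dynkin's lemma over all Borel sets.
\<close>

theorem fourier_uniqueness:
  assumes b: "0 < b" and h: "fourier_null b h" and supp: "\<And>t. t \<notin> window b 0 \<Longrightarrow> h t = 0"
  shows "AE t in lborel. h t = 0"
proof (rule sigma_finite_measure.density_zero[OF lborel.sigma_finite_measure_axioms])
  show h_int: "integrable lborel h" using h by (simp add: fourier_null_def)
  then have [measurable]: "h \<in> borel_measurable borel"
    using borel_measurable_integrable by force
  have int: "integrable lborel (\<lambda>t. h t * indicator A t)" if "A \<in> sets borel" for A
    using that by (intro integrable_bounded_mult[OF h_int, where C = 1]) (auto split: split_indicator)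
  have closed: "(LINT t|lborel. h t * indicator C t) = 0" if C: "closed C" for C
  proof -
    (* The right endpoint of the window is missing; stopping short of it makes D n compact. *)
    define D where "D n = C \<inter> {0..1 / b - 1 / (real n + 1)}" for n :: nat
    have D: "compact (D n)" for n unfolding D_def using C by (intro closed_Int_compact) auto
    have D_window: "D n \<subseteq> window b 0" for n
    proof
      fix t assume "t \<in> D n"
      moreover have "0 < 1 / (real n + 1)" by simp
      ultimately have "0 \<le> t" "t < 1 / b" unfolding D_def Int_iff atLeastAtMost_iff by linarith+
      then show "t \<in> window b 0" by (simp add: window_def)
    qed
    have "continuous_on UNIV (character b 1)"
      unfolding character_def cis_conv_exp by (intro continuous_intros)
    then have cl: "closed (character b 1 ` D n)" for n
      using D by (intro compact_imp_closed compact_continuous_image) (auto intro: continuous_on_subset)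
    have eq: "h t * indicator (character b 1 ` D n) (character b 1 t) = h t * indicator (D n) t" for t n
    proof (cases "t \<in> window b 0")
      case True
      then have "character b 1 t \<in> character b 1 ` D n \<longleftrightarrow> t \<in> D n"
        using inj_on_image_mem_iff[OF character_inj_on_window[OF b] _ D_window] by simp
      then show ?thesis by (simp split: split_indicator)
    qed (simp add: supp)
    have zero: "(LINT t|lborel. h t * indicator (D n) t) = 0" for n
      using fourier_null_closed[OF h cl[of n]] unfolding eq .
    have [measurable]: "C \<in> sets borel" using C by simp
    have [measurable]: "D n \<in> sets borel" for n
      using compact_imp_closed[OF D] by simp
    have "(\<lambda>n. LINT t|lborel. h t * indicator (D n) t) \<longlonglongrightarrow> (LINT t|lborel. h t * indicator C t)"
    proof (rule integral_dominated_convergence[where w = "\<lambda>t. cmod (h t)"])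
      show "AE t in lborel. (\<lambda>n. h t * indicator (D n) t) \<longlonglongrightarrow> h t * indicator C t"
      proof (intro AE_I2)
        fix t
        show "(\<lambda>n. h t * indicator (D n) t) \<longlonglongrightarrow> h t * indicator C t"
        proof (cases "t \<in> window b 0")
          case True
          then have t: "0 \<le> t" "0 < 1 / b - t" by (auto simp: window_def)
          obtain N where N: "inverse (real (Suc N)) < 1 / b - t" using reals_Archimedean[OF t(2)] by blast
          have "\<forall>\<^sub>F n in sequentially. h t * indicator (D n) t = h t * indicator C t"
            using eventually_ge_at_top[of N]
          proof eventually_elim
            case (elim n)
            then have "1 / (real n + 1) \<le> inverse (real (Suc N))"
              by (simp add: field_simps)
            then have "t \<in> {0..1 / b - 1 / (real n + 1)}" using t N by simp
            then show ?case by (simp add: D_def indicator_inter_arith)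
          qed
          then show ?thesis by (rule tendsto_eventually)
        qed (simp add: supp)
      qed
    qed (use h_int in \<open>auto split: split_indicator\<close>)
    then show ?thesis unfolding zero by (simp add: LIMSEQ_const_iff)
  qed
  fix A :: "real set" assume "A \<in> sets lborel"
  then have A: "A \<in> sigma_sets UNIV {C. closed C}"
    by (simp add: borel_eq_closed)
  have int_stable: "Int_stable {C::real set. closed C}"
    by (auto intro: Int_stableI)
  have sub: "{C::real set. closed C} \<subseteq> Pow UNIV" by simp
  from int_stable sub A have "(LINT t|lborel. h t * indicator A t) = 0"
  proof (induction rule: sigma_sets_induct_disjoint)
    case (basic A) then show ?case using closed by simp
  next
    case empty then show ?case by simp
  next
    case (compl A)
    then have [measurable]: "A \<in> sets borel" by (simp add: borel_eq_closed)
    have "h t * indicator (UNIV - A) t = h t * indicator UNIV t - h t * indicator A t" for t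
      by (simp split: split_indicator)
    then show ?case using compl.IH closed[of UNIV] int[of UNIV] int[of A] by simp
  next
    case (union A)
    then have A: "A i \<in> sets borel" for i by (auto simp: borel_eq_closed)
    have "(LINT t:(\<Union>i. A i)|lborel. h t) = (\<Sum>i. LINT t:(A i)|lborel. h t)"
    proof (rule lebesgue_integral_countable_add)
      show "set_integrable lborel (\<Union>i. A i) h"
        unfolding set_integrable_def using int[of "\<Union>i. A i"] A
        by (simp add: scaleR_conv_of_real mult.commute of_real_indicator)
    qed (use A union in \<open>auto simp: disjoint_family_on_def\<close>)
    also have "\<dots> = 0"
      using union.IH by (simp add: set_lebesgue_integral_def scaleR_conv_of_real mult.commute of_real_indicator)
    finally show ?case
      by (simp add: set_lebesgue_integral_def scaleR_conv_of_real mult.commute of_real_indicator)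
  qed
  then show "set_lebesgue_integral lborel A h = 0"
    by (simp add: set_lebesgue_integral_def scaleR_conv_of_real mult.commute of_real_indicator)
qed

definition window_character :: "real \<Rightarrow> int \<Rightarrow> real \<Rightarrow> complex" where
  "window_character b m t = indicator (window b 0) t * character b m t"

lemma window_character_measurable [measurable]: "window_character b m \<in> borel_measurable borel"
  unfolding window_character_def by measurable

lemma indicator_L2:
  assumes "A \<in> sets borel" "emeasure lborel A < \<infinity>"
  shows "(\<lambda>t. indicator A t :: complex) \<in> L2"
proof (rule L2_I)
  have "integrable lborel (indicator A :: real \<Rightarrow> real)"
    using assms by simp
  moreover have "(\<lambda>t. (cmod (indicator A t))\<^sup>2) = (indicator A :: real \<Rightarrow> real)"
    by (auto split: split_indicator)
  ultimately show "integrable lborel (\<lambda>t. (cmod (indicator A t))\<^sup>2)" by simp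
qed (use assms in measurable)

lemma window_indicator_L2: "0 < b \<Longrightarrow> (\<lambda>t. indicator (window b j) t :: complex) \<in> L2"
  by (rule indicator_L2) (auto simp: window_def divide_right_mono)

lemma window_character_L2:
  assumes "0 < b" shows "window_character b m \<in> L2"
  by (rule L2_dominated[OF window_indicator_L2[OF assms, of 0], where C = 1])
    (simp_all add: window_character_measurable, simp add: window_character_def norm_mult)

lemma inner_window_character:
  assumes "\<And>t. t \<notin> window b 0 \<Longrightarrow> f t = 0"
  shows "l2_inner f (window_character b m) = l2_inner f (character b m)"
  unfolding l2_inner_def
  by (rule Bochner_Integration.integral_cong) (use assms in \<open>auto simp: window_character_def split: split_indicator\<close>)

lemma window_character_orthogonal:
  assumes b: "0 < b"
  shows "l2_inner (window_character b m) (window_character b n) = (if m = n then complex_of_real (1 / b) else 0)"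
proof -
  have win: "window b 0 = {0..<1/b}" by (simp add: window_def)
  have "l2_inner (window_character b m) (window_character b n)
      = (LINT t|lborel. indicator {0..1/b} t *\<^sub>R character b (m - n) t)"
    unfolding l2_inner_def
  proof (rule integral_cong_AE)
    show "AE t in lborel. window_character b m t * cnj (window_character b n t)
        = indicator {0..1/b} t *\<^sub>R character b (m - n) t"
      using AE_lborel_singleton[of "1/b"]
    proof eventually_elim
      case (elim t)
      then show ?case using character_mult[of b m t "-n"]
        by (auto simp: window_character_def win cnj_character split: split_indicator)
    qed
    show "(\<lambda>t. window_character b m t * cnj (window_character b n t)) \<in> borel_measurable lborel" by simp
  qed simp
  also have "\<dots> = (if m = n then complex_of_real (1 / b) else 0)"
  proof (cases "m = n")
    case True
    have "(LINT t|lborel. indicator {0..1/b} t *\<^sub>R (1::complex)) = measure lborel {0..1/b} *\<^sub>R 1"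
      by (simp add: scaleR_conv_of_real)
    then show ?thesis using True b by (simp add: scaleR_conv_of_real)
  next
    case False
    define c where "c = 2 * pi * of_int (m - n) * b"
    have c: "c \<noteq> 0" using False b by (simp add: c_def)
    have "(LINT t|lborel. indicator {0..1/b} t *\<^sub>R cis (c * t))
        = cis (c * (1/b)) / (\<i> * of_real c) - cis (c * 0) / (\<i> * of_real c)"
    proof (rule integral_FTC_Icc)
      fix x
      have "((\<lambda>t. exp (\<i> * of_real (c * t)) / (\<i> * of_real c)) has_vector_derivative
          exp (\<i> * of_real (c * x)) * (\<i> * of_real c) / (\<i> * of_real c)) (at x within {0..1/b})"
        by (auto intro!: derivative_eq_intros has_vector_derivative_real_field simp: c)
        (simp add: complex_eq_iff)
      then show "((\<lambda>t. cis (c * t) / (\<i> * of_real c)) has_vector_derivative cis (c * x)) (at x within {0..1/b})"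
        using c by (simp add: cis_conv_exp)
    qed (use b in \<open>auto intro!: continuous_intros\<close>)
    also have "cis (c * (1/b)) = 1"
      using b cis_multiple_2pi[of "of_int (m - n)"] by (simp add: c_def)
    finally show ?thesis using False by (simp add: character_def c_def)
  qed
  finally show ?thesis .
qed

text \<open>
  The usual expansion of \<open>0 \<le> \<parallel>f - v\<parallel>\<^sup>2\<close>, with \<open>v\<close> the partial Fourier sum; the factor \<open>b\<close> in \<open>v\<close>
  comes from \<open>\<parallel>window_character b m\<parallel>\<^sup>2 = 1/b\<close>.
\<close>

lemma window_Bessel:
  assumes b: "0 < b" and f: "f \<in> L2" and F: "finite F"
  shows "(\<Sum>m\<in>F. (cmod (l2_inner f (window_character b m)))\<^sup>2) \<le> 1 / b * (l2_norm f)\<^sup>2"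
proof -
  let ?\<chi> = "window_character b"
  define c where "c m = l2_inner f (?\<chi> m)" for m
  define v where "v t = (\<Sum>m\<in>F. (of_real b * c m) * ?\<chi> m t)" for t
  have \<chi>: "?\<chi> m \<in> L2" for m by (rule window_character_L2[OF b])
  have v: "v \<in> L2" unfolding v_def by (intro L2_sum L2_scale \<chi>)
  define S where "S = (\<Sum>m\<in>F. (cmod (c m))\<^sup>2)"
  have v_inner: "l2_inner v h = (\<Sum>m\<in>F. of_real b * c m * l2_inner (?\<chi> m) h)" if "h \<in> L2" for h
    unfolding v_def using that by (simp add: l2_inner_sum_left L2_scale \<chi> l2_inner_scale_left)
  have vf: "l2_inner v f = of_real (b * S)"
    unfolding v_inner[OF f] S_def
    by (simp add: l2_inner_cnj[of _ f] c_def[symmetric] sum_distrib_left complex_norm_square mult_ac del: of_real_power)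
  have \<chi>v: "l2_inner (?\<chi> m) v = cnj (c m)" if "m \<in> F" for m
  proof -
    have "l2_inner v (?\<chi> m) = (\<Sum>k\<in>F. if k = m then c m else 0)"
      unfolding v_inner[OF \<chi>] window_character_orthogonal[OF b] using b
      by (intro sum.cong) auto
    also have "\<dots> = c m" using that F by simp
    finally show ?thesis by (simp add: l2_inner_cnj[of _ v])
  qed
  have "complex_of_real ((l2_norm v)\<^sup>2) = l2_inner v v" by (rule l2_inner_self[symmetric])
  also have "\<dots> = of_real (b * S)"
    unfolding v_inner[OF v] S_def
    by (simp add: \<chi>v sum_distrib_left complex_norm_square mult_ac del: of_real_power)
  finally have nv: "(l2_norm v)\<^sup>2 = b * S" using of_real_eq_iff by blast
  have "0 \<le> (l2_norm (\<lambda>t. f t + (-1) * v t))\<^sup>2" by simp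
  also have "\<dots> = (l2_norm f)\<^sup>2 - b * S"
    unfolding l2_norm_add_sq[OF f L2_scale[OF v]] l2_inner_scale_right l2_norm_scale
    by (simp add: l2_inner_cnj[of f] vf nv)
  finally have "b * S \<le> (l2_norm f)\<^sup>2" by simp
  then show ?thesis using b by (simp add: S_def c_def field_simps)
qed

text \<open>
  The Fourier series of \<open>F\<close> converges to some \<open>u\<close>. All coefficients of \<open>F - u\<close> vanish, so \<open>F = u\<close>
  on the window, and pairing the series with \<open>H\<close> gives the formula.
\<close>

theorem window_Parseval:
  assumes b: "0 < b" and F: "F \<in> L2" and H: "H \<in> L2"
    and F0: "\<And>t. t \<notin> window b 0 \<Longrightarrow> F t = 0" and H0: "\<And>t. t \<notin> window b 0 \<Longrightarrow> H t = 0"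
  shows "((\<lambda>m. l2_inner F (character b m) * cnj (l2_inner H (character b m)))
    has_sum (complex_of_real (1 / b) * l2_inner F H)) UNIV"
proof -
  let ?\<chi> = "window_character b"
  define c where "c m = l2_inner F (?\<chi> m)" for m
  have \<chi>: "?\<chi> m \<in> L2" for m by (rule window_character_L2[OF b])
  have [measurable]: "F \<in> borel_measurable borel" using L2_measurable[OF F] by simp
  have [measurable]: "H \<in> borel_measurable borel" using L2_measurable[OF H] by simp
  have "(\<lambda>m. (cmod (c m))\<^sup>2) summable_on UNIV"
  proof (rule nonneg_bounded_partial_sums_imp_summable_on)
    show "\<forall>\<^sub>F X in finite_subsets_at_top UNIV. (\<Sum>m\<in>X. (cmod (c m))\<^sup>2) \<le> 1 / b * (l2_norm F)\<^sup>2"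
      unfolding c_def by (rule eventually_finite_subsets_at_top_weakI) (rule window_Bessel[OF b F])
  qed simp
  then have "(\<lambda>m. (cmod (of_real b * c m))\<^sup>2) summable_on UNIV"
    by (simp add: norm_mult power_mult_distrib summable_on_cmult_right)
  then obtain u where u: "l2_has_sum (\<lambda>m t. (of_real b * c m) * ?\<chi> m t) u"
    using Bessel_synthesis[of ?\<chi> "1 / b" "\<lambda>m. of_real b * c m", OF \<chi> window_Bessel[OF b]] by blast
  then have uL: "u \<in> L2" by (simp add: l2_has_sum_def)
  have [measurable]: "u \<in> borel_measurable borel" using L2_measurable[OF uL] by simp
  have coeff: "l2_inner u (?\<chi> k) = c k" for k
  proof -
    have "((\<lambda>m. of_real b * c m * l2_inner (?\<chi> m) (?\<chi> k)) has_sum l2_inner u (?\<chi> k)) UNIV"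
      using l2_has_sum_inner[OF u \<chi>[of k]] by (simp add: l2_inner_scale_left)
    moreover have "((\<lambda>m. of_real b * c m * l2_inner (?\<chi> m) (?\<chi> k)) has_sum c k) UNIV"
      by (rule has_sum_finite_neutralI[of "{k}"]) (use b in \<open>auto simp: window_character_orthogonal[OF b]\<close>)
    ultimately show ?thesis by (rule has_sum_unique)
  qed
  define h where "h t = indicator (window b 0) t * (F t - u t)" for t
  have "AE t in lborel. h t = 0"
  proof (rule fourier_uniqueness[OF b])
    have "(\<lambda>t. (F t - u t) * cnj (indicator (window b 0) t)) = h"
      by (auto simp: h_def split: split_indicator)
    then have "integrable lborel h"
      using integrable_inner[OF L2_diff[OF F uL] window_indicator_L2[OF b, of 0]] by simp
    moreover have "(LINT t|lborel. h t * cnj (character b m t)) = 0" for m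
    proof -
      have "(LINT t|lborel. h t * cnj (character b m t)) = l2_inner (\<lambda>t. F t - u t) (?\<chi> m)"
        unfolding l2_inner_def h_def window_character_def
        by (rule Bochner_Integration.integral_cong) (auto split: split_indicator)
      also have "\<dots> = 0" by (simp add: l2_inner_diff_left F uL \<chi> coeff c_def)
      finally show ?thesis .
    qed
    ultimately show "fourier_null b h" by (simp add: fourier_null_def)
  qed (simp add: h_def)
  then have "l2_inner u H = l2_inner F H"
    unfolding l2_inner_def
  proof (intro integral_cong_AE)
    assume "AE t in lborel. h t = 0"
    then show "AE t in lborel. u t * cnj (H t) = F t * cnj (H t)"
    proof eventually_elim
      case (elim t)
      then show ?case using H0[of t] by (cases "t \<in> window b 0") (auto simp: h_def)
    qed
  qed simp_all
  then have "((\<lambda>m. of_real b * c m * l2_inner (?\<chi> m) H) has_sum l2_inner F H) UNIV"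
    using l2_has_sum_inner[OF u H] by (simp add: l2_inner_scale_left)
  from has_sum_cmult_right[OF this, of "1 / of_real b"]
  have "((\<lambda>m. c m * l2_inner (?\<chi> m) H) has_sum (1 / of_real b * l2_inner F H)) UNIV"
    using b by simp
  then show ?thesis
    unfolding c_def l2_inner_cnj[of _ H]
    by (simp add: inner_window_character[OF F0] inner_window_character[OF H0])
qed

text \<open>
  The coefficients do not change under translation by multiples of \<open>1/b\<close>. Moving both functions to
  the window \<open>0\<close> displaces them by \<open>(j - i)/b\<close> relative to each other.
\<close>

corollary shifted_window_Parseval:
  assumes b: "0 < b" and F: "F \<in> L2" and H: "H \<in> L2"
    and F0: "\<And>t. t \<notin> window b i \<Longrightarrow> F t = 0" and H0: "\<And>t. t \<notin> window b j \<Longrightarrow> H t = 0"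
  shows "((\<lambda>m. l2_inner F (character b m) * cnj (l2_inner H (character b m)))
    has_sum (complex_of_real (1 / b) * (LINT t|lborel. F (t - of_int (j - i) / b) * cnj (H t)))) UNIV"
proof -
  have shift: "t + of_int k / b \<in> window b k \<longleftrightarrow> t \<in> window b 0" for t k
    by (auto simp: window_def add_divide_distrib)
  have coeff: "l2_inner (\<lambda>t. f (t + of_int k / b)) (character b m) = l2_inner f (character b m)" for f k m
    unfolding l2_inner_def
    using integral_translate[of "\<lambda>t. f (t + of_int k / b) * cnj (character b m t)" "of_int k / b"]
      character_periodic[of b m _ "- k"] b by simp
  have "l2_inner (\<lambda>t. F (t + of_int i / b)) (\<lambda>t. H (t + of_int j / b))
      = (LINT t|lborel. F (t - of_int (j - i) / b) * cnj (H t))"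
    unfolding l2_inner_def
    using integral_translate[of "\<lambda>t. F (t + of_int i / b) * cnj (H (t + of_int j / b))" "of_int j / b"]
    by (simp add: diff_divide_distrib algebra_simps)
  moreover have "((\<lambda>m. l2_inner (\<lambda>t. F (t + of_int i / b)) (character b m)
      * cnj (l2_inner (\<lambda>t. H (t + of_int j / b)) (character b m)))
    has_sum (complex_of_real (1 / b) * l2_inner (\<lambda>t. F (t + of_int i / b)) (\<lambda>t. H (t + of_int j / b)))) UNIV"
    using L2_translate[OF F, of "- (of_int i / b)"] L2_translate[OF H, of "- (of_int j / b)"]
    by (intro window_Parseval[OF b]) (auto intro: F0 H0 simp: shift)
  ultimately show ?thesis by (simp add: coeff)
qed

section \<open>Measurability and integration of unordered series\<close>

lemma summable_on_int_iff:
  fixes x :: "int \<Rightarrow> complex"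
  shows "x summable_on UNIV \<longleftrightarrow> summable (\<lambda>i. norm (x (int_decode i)))"
proof -
  have "x summable_on UNIV \<longleftrightarrow> (\<lambda>i. x (int_decode i)) summable_on UNIV"
    by (rule summable_on_reindex_bij_betw[OF bij_int_decode, symmetric])
  also have "\<dots> \<longleftrightarrow> (\<lambda>i. norm (x (int_decode i))) summable_on UNIV"
    by (rule summable_on_iff_abs_summable_on_complex)
  finally show ?thesis by (simp add: summable_on_UNIV_nonneg_real_iff)
qed

text \<open>
  Enumerating the integers makes the measurability and integration theory of ordinary series
  available. Both sides are 0 for a divergent series.
\<close>

lemma infsum_int_eq:
  fixes x :: "int \<Rightarrow> complex"
  shows "(\<Sum>\<^sub>\<infinity>n. x n)
    = (if summable (\<lambda>i. norm (x (int_decode i))) then \<Sum>i. x (int_decode i) else 0)"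
proof (cases "x summable_on UNIV")
  case True
  then have "((\<lambda>i. x (int_decode i)) has_sum (\<Sum>\<^sub>\<infinity>n. x n)) UNIV"
    using has_sum_reindex_bij_betw[OF bij_int_decode, of x] by simp
  then have "(\<lambda>i. x (int_decode i)) sums (\<Sum>\<^sub>\<infinity>n. x n)" by (rule has_sum_imp_sums)
  then show ?thesis using True by (simp add: summable_on_int_iff sums_iff)
next
  case False
  then show ?thesis by (simp add: infsum_not_exists summable_on_int_iff)
qed

lemma infsum_int_measurable:
  fixes \<phi> :: "int \<Rightarrow> real \<Rightarrow> complex"
  assumes [measurable]: "\<And>n. \<phi> n \<in> borel_measurable borel"
  shows "(\<lambda>t. \<Sum>\<^sub>\<infinity>n. \<phi> n t) \<in> borel_measurable borel"
proof -
  have "summable (\<lambda>i. norm (\<phi> (int_decode i) t))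
      \<longleftrightarrow> Cauchy (\<lambda>N. \<Sum>i<N. norm (\<phi> (int_decode i) t))" for t
    by (simp add: summable_iff_convergent Cauchy_convergent_iff)
  then show ?thesis unfolding infsum_int_eq by simp
qed

text \<open>Fubini for a series of functions whose finite absolute sums share an integrable majorant.\<close>

lemma has_sum_integral_infsum:
  fixes \<phi> :: "int \<Rightarrow> real \<Rightarrow> complex"
  assumes [measurable]: "\<And>n. \<phi> n \<in> borel_measurable borel"
    and w: "integrable lborel w"
    and bound: "AE t in lborel. \<forall>F. finite F \<longrightarrow> (\<Sum>n\<in>F. cmod (\<phi> n t)) \<le> w t"
  shows "((\<lambda>n. LINT t|lborel. \<phi> n t) has_sum (LINT t|lborel. (\<Sum>\<^sub>\<infinity>n. \<phi> n t))) UNIV"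
proof -
  let ?\<psi> = "\<lambda>i t. \<phi> (int_decode i) t"
  have partial: "(\<Sum>i<N. cmod (?\<psi> i t)) \<le> w t"
    if "\<forall>F. finite F \<longrightarrow> (\<Sum>n\<in>F. cmod (\<phi> n t)) \<le> w t" for N t
  proof -
    have "(\<Sum>i<N. cmod (?\<psi> i t)) = (\<Sum>n\<in>int_decode ` {..<N}. cmod (\<phi> n t))"
      by (subst sum.reindex) (auto intro: inj_on_subset[OF inj_int_decode])
    then show ?thesis using that by simp
  qed
  have int: "integrable lborel (?\<psi> i)" for i
  proof (rule Bochner_Integration.integrable_bound[OF w])
    show "AE t in lborel. norm (?\<psi> i t) \<le> norm (w t)"
      using bound
    proof eventually_elim
      case (elim t)
      then have "(\<Sum>n\<in>{int_decode i}. cmod (\<phi> n t)) \<le> w t" by blast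
      then show ?case by simp
    qed
  qed simp
  have AE: "AE t in lborel. summable (\<lambda>i. norm (?\<psi> i t))"
    using bound
  proof eventually_elim
    case (elim t)
    then show ?case by (intro summableI_nonneg_bounded[of _ "w t"] partial) auto
  qed
  have sum: "summable (\<lambda>i. LINT t|lborel. norm (?\<psi> i t))"
  proof (rule summableI_nonneg_bounded)
    fix N
    have "(\<Sum>i<N. LINT t|lborel. norm (?\<psi> i t)) = (LINT t|lborel. (\<Sum>i<N. norm (?\<psi> i t)))"
      using int by (simp add: Bochner_Integration.integral_sum)
    also have "\<dots> \<le> (LINT t|lborel. w t)"
    proof (rule integral_mono_AE[OF _ w])
      show "AE t in lborel. (\<Sum>i<N. norm (?\<psi> i t)) \<le> w t"
        using bound by eventually_elim (rule partial)
    qed (use int in auto)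
    finally show "(\<Sum>i<N. LINT t|lborel. norm (?\<psi> i t)) \<le> (LINT t|lborel. w t)" .
  qed simp
  have "(\<lambda>i. LINT t|lborel. ?\<psi> i t) sums (LINT t|lborel. (\<Sum>i. ?\<psi> i t))"
    by (rule sums_integral[OF int AE sum])
  also have "(LINT t|lborel. (\<Sum>i. ?\<psi> i t)) = (LINT t|lborel. (\<Sum>\<^sub>\<infinity>n. \<phi> n t))"
  proof (rule integral_cong_AE)
    show "AE t in lborel. (\<Sum>i. ?\<psi> i t) = (\<Sum>\<^sub>\<infinity>n. \<phi> n t)"
      using AE by eventually_elim (simp add: infsum_int_eq)
    show "(\<lambda>t. \<Sum>\<^sub>\<infinity>n. \<phi> n t) \<in> borel_measurable lborel"
      using infsum_int_measurable[of \<phi>] by simp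
  qed simp
  finally have sums: "(\<lambda>i. LINT t|lborel. ?\<psi> i t) sums (LINT t|lborel. (\<Sum>\<^sub>\<infinity>n. \<phi> n t))" .
  have "summable (\<lambda>i. norm (LINT t|lborel. ?\<psi> i t))"
    by (rule summable_comparison_test'[OF sum]) (simp add: integral_norm_bound)
  from norm_summable_imp_has_sum[OF this sums] show ?thesis
    using has_sum_reindex_bij_betw[OF bij_int_decode, of "\<lambda>n. LINT t|lborel. \<phi> n t"] by simp
qed

section \<open>Preframe functions\<close>

locale preframe =
  fixes a b :: real and g :: "real \<Rightarrow> complex"
  assumes b_pos: "0 < b" and g_PF: "g \<in> PF a b"
begin

lemma g_L2: "g \<in> L2"
  using g_PF by (simp add: PF_def)

lemma g_measurable [measurable]: "g \<in> borel_measurable borel"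
  using L2_measurable[OF g_L2] by simp

lemma wh_eq: "wh g a b (m, n) t = character b m t * g (t - of_int n * a)"
  by (simp add: wh_def modulation_def translation_def character_def cis_conv_exp mult_ac)

lemma wh_L2: "wh g a b p \<in> L2"
proof (cases p)
  case (Pair m n)
  show ?thesis unfolding Pair
    by (rule L2_dominated[OF L2_translate[OF g_L2, of "of_int n * a"], where C = 1])
      (simp_all add: wh_eq[abs_def] norm_mult)
qed

lemma inner_wh:
  "l2_inner f (wh g a b (m, n)) = l2_inner (\<lambda>t. f t * cnj (g (t - of_int n * a))) (character b m)"
  by (simp add: l2_inner_def wh_eq mult_ac)

text \<open>
  Chosen nonnegative, so that it can be used as a factor in estimates.
\<close>

definition frame_bound :: real where
  "frame_bound = (SOME B. 0 \<le> B \<and> (\<forall>f\<in>L2.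
     (\<lambda>p. (cmod (l2_inner f (wh g a b p)))\<^sup>2) summable_on UNIV \<and>
     (\<Sum>\<^sub>\<infinity>p. (cmod (l2_inner f (wh g a b p)))\<^sup>2) \<le> B * (l2_norm f)\<^sup>2))"

lemma
  shows frame_bound_nonneg: "0 \<le> frame_bound"
    and coeff_summable: "f \<in> L2 \<Longrightarrow> (\<lambda>p. (cmod (l2_inner f (wh g a b p)))\<^sup>2) summable_on UNIV"
    and coeff_infsum_le: "f \<in> L2 \<Longrightarrow>
      (\<Sum>\<^sub>\<infinity>p. (cmod (l2_inner f (wh g a b p)))\<^sup>2) \<le> frame_bound * (l2_norm f)\<^sup>2"
proof -
  obtain B where B: "\<forall>f\<in>L2. (\<lambda>p. (cmod (l2_inner f (wh g a b p)))\<^sup>2) summable_on UNIV \<and>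
     (\<Sum>\<^sub>\<infinity>p. (cmod (l2_inner f (wh g a b p)))\<^sup>2) \<le> B * (l2_norm f)\<^sup>2"
    using g_PF by (auto simp: PF_def)
  have "B * (l2_norm f)\<^sup>2 \<le> \<bar>B\<bar> * (l2_norm f)\<^sup>2" for f
    by (rule mult_right_mono) auto
  with B have "0 \<le> \<bar>B\<bar> \<and> (\<forall>f\<in>L2. (\<lambda>p. (cmod (l2_inner f (wh g a b p)))\<^sup>2) summable_on UNIV \<and>
     (\<Sum>\<^sub>\<infinity>p. (cmod (l2_inner f (wh g a b p)))\<^sup>2) \<le> \<bar>B\<bar> * (l2_norm f)\<^sup>2)"
    by (meson abs_ge_zero order_trans)
  from someI[of "\<lambda>B. 0 \<le> B \<and> (\<forall>f\<in>L2. (\<lambda>p. (cmod (l2_inner f (wh g a b p)))\<^sup>2) summable_on UNIV \<and>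
     (\<Sum>\<^sub>\<infinity>p. (cmod (l2_inner f (wh g a b p)))\<^sup>2) \<le> B * (l2_norm f)\<^sup>2)", OF this]
  show "0 \<le> frame_bound"
    and "f \<in> L2 \<Longrightarrow> (\<lambda>p. (cmod (l2_inner f (wh g a b p)))\<^sup>2) summable_on UNIV"
    and "f \<in> L2 \<Longrightarrow> (\<Sum>\<^sub>\<infinity>p. (cmod (l2_inner f (wh g a b p)))\<^sup>2) \<le> frame_bound * (l2_norm f)\<^sup>2"
    unfolding frame_bound_def by blast+
qed

lemma coeff_sum_le:
  assumes "f \<in> L2" "finite P"
  shows "(\<Sum>p\<in>P. (cmod (l2_inner f (wh g a b p)))\<^sup>2) \<le> frame_bound * (l2_norm f)\<^sup>2"
  using finite_sum_le_infsum[OF coeff_summable[OF assms(1)] assms(2)] coeff_infsum_le[OF assms(1)]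
  by simp

text \<open>
  An almost everywhere bound for \<open>\<Sum>\<^sub>n |g(t - na)|\<^sup>2\<close> and hence for every \<open>|G\<^sub>k(t)|\<close>.
\<close>

definition G_bound :: real where "G_bound = b * frame_bound"

lemma G_bound_nonneg: "0 \<le> G_bound"
  unfolding G_bound_def using b_pos frame_bound_nonneg by simp

text \<open>
  The frame inequality for the indicator of \<open>A\<close>. Since \<open>A\<close> lies in one window, Parseval's formula
  identifies the sum over \<open>m\<close> of the squared coefficients with \<open>1/b\<close> times the integral of
  \<open>|g(t - na)|\<^sup>2\<close> over \<open>A\<close>.
\<close>

lemma square_sum_integral_le:
  assumes A: "A \<in> sets borel" "A \<subseteq> window b j" and F: "finite F"
  shows "(LINT t|lborel. indicator A t * (\<Sum>n\<in>F. (cmod (g (t - of_int n * a)))\<^sup>2))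
    \<le> G_bound * (LINT t|lborel. indicator A t)"
proof -
  define f where "f t = (indicator A t :: complex)" for t
  have f: "f \<in> L2"
    unfolding f_def
  proof (rule indicator_L2[OF A(1)])
    have "emeasure lborel A \<le> emeasure lborel (window b j)"
      by (rule emeasure_mono[OF A(2)]) simp
    also have "\<dots> < \<infinity>" using b_pos by (simp add: window_def divide_right_mono)
    finally show "emeasure lborel A < \<infinity>" .
  qed
  have gn: "(\<lambda>t. g (t - of_int n * a)) \<in> L2" for n by (rule L2_translate[OF g_L2])
  define F' where "F' n t = f t * cnj (g (t - of_int n * a))" for n t
  have F': "F' n \<in> L2" for n
    by (rule L2_dominated[OF gn[of n], where C = 1])
      (use A in \<open>auto simp: F'_def[abs_def] f_def norm_mult split: split_indicator\<close>)
  define I where "I n = (LINT t|lborel. indicator A t * (cmod (g (t - of_int n * a)))\<^sup>2)" for n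
  have int_n: "integrable lborel (\<lambda>t. indicator A t * (cmod (g (t - of_int n * a)))\<^sup>2)" for n
    using integrable_mult_indicator[OF _ L2_integrable_sq[OF gn[of n]], of A] A by simp
  have Parseval: "((\<lambda>m. (cmod (l2_inner f (wh g a b (m, n))))\<^sup>2) has_sum (1 / b * I n)) UNIV" for n
  proof -
    have "F' n t = 0" if "t \<notin> window b j" for t
      using that A(2) by (auto simp: F'_def f_def split: split_indicator)
    then have "((\<lambda>m. l2_inner (F' n) (character b m) * cnj (l2_inner (F' n) (character b m)))
        has_sum (complex_of_real (1 / b) * (LINT t|lborel. F' n t * cnj (F' n t)))) UNIV"
      using shifted_window_Parseval[OF b_pos F'[of n] F'[of n], of j j] by simp
    moreover have "(LINT t|lborel. F' n t * cnj (F' n t)) = complex_of_real (I n)"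
      unfolding I_def integral_complex_of_real[symmetric]
      by (rule Bochner_Integration.integral_cong)
        (auto simp: F'_def f_def complex_norm_square mult.commute simp del: of_real_power split: split_indicator)
    ultimately have "((\<lambda>m. l2_inner (F' n) (character b m) * cnj (l2_inner (F' n) (character b m)))
        has_sum complex_of_real (1 / b * I n)) UNIV"
      by simp
    then have "((\<lambda>m. complex_of_real ((cmod (l2_inner f (wh g a b (m, n))))\<^sup>2))
        has_sum complex_of_real (1 / b * I n)) UNIV"
      unfolding complex_norm_square inner_wh F'_def[abs_def] .
    then show ?thesis by (simp only: has_sum_of_real_iff)
  qed
  have "1 / b * (\<Sum>n\<in>F. I n) \<le> frame_bound * (l2_norm f)\<^sup>2"
  proof -
    have lim: "((\<lambda>M. \<Sum>n\<in>F. \<Sum>m\<in>M. (cmod (l2_inner f (wh g a b (m, n))))\<^sup>2)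
        \<longlongrightarrow> (\<Sum>n\<in>F. 1 / b * I n)) (finite_subsets_at_top UNIV)"
      by (intro tendsto_sum) (use Parseval in \<open>simp add: has_sum_def\<close>)
    have "(\<Sum>n\<in>F. 1 / b * I n) \<le> frame_bound * (l2_norm f)\<^sup>2"
    proof (rule tendsto_upperbound[OF lim])
      show "\<forall>\<^sub>F M in finite_subsets_at_top UNIV.
          (\<Sum>n\<in>F. \<Sum>m\<in>M. (cmod (l2_inner f (wh g a b (m, n))))\<^sup>2) \<le> frame_bound * (l2_norm f)\<^sup>2"
      proof (rule eventually_finite_subsets_at_top_weakI)
        fix M :: "int set" assume "finite M"
        then have "(\<Sum>p\<in>M \<times> F. (cmod (l2_inner f (wh g a b p)))\<^sup>2) \<le> frame_bound * (l2_norm f)\<^sup>2"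
          using F by (intro coeff_sum_le f) auto
        also have "(\<Sum>p\<in>M \<times> F. (cmod (l2_inner f (wh g a b p)))\<^sup>2)
            = (\<Sum>n\<in>F. \<Sum>m\<in>M. (cmod (l2_inner f (wh g a b (m, n))))\<^sup>2)"
          by (subst sum.swap) (simp add: sum.cartesian_product split_def)
        finally show "(\<Sum>n\<in>F. \<Sum>m\<in>M. (cmod (l2_inner f (wh g a b (m, n))))\<^sup>2)
          \<le> frame_bound * (l2_norm f)\<^sup>2" .
      qed
    qed simp
    then show ?thesis by (simp add: sum_distrib_left)
  qed
  moreover have "(l2_norm f)\<^sup>2 = (LINT t|lborel. indicator A t)"
    unfolding l2_norm_sq f_def
    by (rule Bochner_Integration.integral_cong) (auto split: split_indicator)
  moreover have "(LINT t|lborel. indicator A t * (\<Sum>n\<in>F. (cmod (g (t - of_int n * a)))\<^sup>2)) = (\<Sum>n\<in>F. I n)"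
    unfolding I_def sum_distrib_left using int_n by (rule Bochner_Integration.integral_sum)
  ultimately show ?thesis
    using b_pos by (simp add: G_bound_def field_simps)
qed

text \<open>
  By \<open>square_sum_integral_le\<close> the part of any window where the claim fails is a null set.
\<close>

lemma square_sum_le:
  assumes F: "finite F"
  shows "AE t in lborel. (\<Sum>n\<in>F. (cmod (g (t - of_int n * a)))\<^sup>2) \<le> G_bound"
proof -
  define s where "s t = (\<Sum>n\<in>F. (cmod (g (t - of_int n * a)))\<^sup>2)" for t
  have [measurable]: "s \<in> borel_measurable borel" unfolding s_def by measurable
  have s_int: "integrable lborel s"
    unfolding s_def by (intro Bochner_Integration.integrable_sum L2_integrable_sq L2_translate g_L2)
  have "AE t in lborel. t \<in> window b j \<longrightarrow> s t \<le> G_bound" for j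
  proof -
    define A where "A = {t \<in> window b j. G_bound < s t}"
    have [measurable]: "A \<in> sets borel" unfolding A_def by measurable
    have A_fin: "emeasure lborel A < \<infinity>"
    proof -
      have "emeasure lborel A \<le> emeasure lborel (window b j)"
        by (rule emeasure_mono) (auto simp: A_def)
      also have "\<dots> < \<infinity>" using b_pos by (simp add: window_def divide_right_mono)
      finally show ?thesis .
    qed
    have ind: "integrable lborel (indicator A :: real \<Rightarrow> real)" using A_fin by simp
    have sA: "integrable lborel (\<lambda>t. indicator A t * s t)"
      using integrable_mult_indicator[OF _ s_int, of A] by simp
    have int: "integrable lborel (\<lambda>t. indicator A t * (s t - G_bound))"
      using Bochner_Integration.integrable_diff[OF sA integrable_mult_left[OF ind, of G_bound]]
      by (simp add: right_diff_distrib)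
    have "(LINT t|lborel. indicator A t * (s t - G_bound))
        = (LINT t|lborel. indicator A t * s t) - G_bound * (LINT t|lborel. indicator A t)"
      using Bochner_Integration.integral_diff[OF sA integrable_mult_left[OF ind, of G_bound]]
      by (simp add: right_diff_distrib mult.commute)
    also have "\<dots> \<le> 0"
      using square_sum_integral_le[of A j F] F by (auto simp: s_def A_def)
    finally have "(LINT t|lborel. indicator A t * (s t - G_bound)) \<le> 0" .
    moreover have nonneg: "0 \<le> indicator A t * (s t - G_bound)" for t
      by (auto simp: A_def split: split_indicator)
    ultimately have "(LINT t|lborel. indicator A t * (s t - G_bound)) = 0"
      by (intro antisym integral_nonneg_AE) auto
    then have "AE t in lborel. indicator A t * (s t - G_bound) = 0"
      using integral_nonneg_eq_0_iff_AE[OF int] nonneg by simp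
    then show ?thesis
      by eventually_elim (auto simp: A_def split: split_indicator_asm)
  qed
  then have "AE t in lborel. \<forall>j. t \<in> window b j \<longrightarrow> s t \<le> G_bound"
    unfolding AE_all_countable by blast
  then show ?thesis
  proof eventually_elim
    case (elim t)
    have "t \<in> window b \<lfloor>b * t\<rfloor>"
      using b_pos floor_correct[of "b * t"] by (simp add: window_def field_simps)
    with elim show ?case unfolding s_def by blast
  qed
qed

text \<open>
  Only countably many \<open>k\<close> and finite \<open>F\<close> occur, so one null set serves them all.
\<close>

lemma shifted_square_sum_le:
  "AE t in lborel. \<forall>k::int. \<forall>F. finite F \<longrightarrow>
    (\<Sum>n\<in>F. (cmod (g (t - of_int n * a - of_int k / b)))\<^sup>2) \<le> G_bound"
proof -
  have "AE t in lborel. (\<Sum>n\<in>F. (cmod (g (t - of_int n * a - of_int k / b)))\<^sup>2) \<le> G_bound"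
    if "finite F" for F and k :: int
  proof -
    have "Measurable.pred borel (\<lambda>t. (\<Sum>n\<in>F. (cmod (g (t - of_int n * a)))\<^sup>2) \<le> G_bound)"
      by measurable
    from AE_borel_affine[OF _ this square_sum_le[OF that], of 1 "- of_int k / b"]
    show ?thesis by (simp add: algebra_simps)
  qed
  moreover have "countable {F :: int set. finite F}"
    by (rule countable_Collect_finite)
  ultimately have "AE t in lborel. \<forall>F\<in>{F. finite F}.
      (\<Sum>n\<in>F. (cmod (g (t - of_int n * a - of_int k / b)))\<^sup>2) \<le> G_bound" for k :: int
    by (subst AE_ball_countable) auto
  then show ?thesis by (simp add: AE_all_countable)
qed

abbreviation G_summand :: "int \<Rightarrow> int \<Rightarrow> real \<Rightarrow> complex" where
  "G_summand k n t \<equiv> g (t - of_int n * a) * cnj (g (t - of_int n * a - of_int k / b))"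

lemma G_summand_sum_le:
  "AE t in lborel. \<forall>k::int. \<forall>F. finite F \<longrightarrow> (\<Sum>n\<in>F. cmod (G_summand k n t)) \<le> G_bound"
  using shifted_square_sum_le
proof (eventually_elim, intro allI impI)
  fix t k and F :: "int set"
  assume bound: "\<forall>k::int. \<forall>F. finite F \<longrightarrow>
      (\<Sum>n\<in>F. (cmod (g (t - of_int n * a - of_int k / b)))\<^sup>2) \<le> G_bound" and F: "finite F"
  have "cmod (G_summand k n t) \<le> ((cmod (g (t - of_int n * a)))\<^sup>2
      + (cmod (g (t - of_int n * a - of_int k / b)))\<^sup>2) / 2" for n
    using sum_squares_bound[of "cmod (g (t - of_int n * a))" "cmod (g (t - of_int n * a - of_int k / b))"]
    by (simp add: norm_mult)
  then have "(\<Sum>n\<in>F. cmod (G_summand k n t)) \<le> (\<Sum>n\<in>F. ((cmod (g (t - of_int n * a)))\<^sup>2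
      + (cmod (g (t - of_int n * a - of_int k / b)))\<^sup>2) / 2)"
    by (intro sum_mono)
  also have "\<dots> \<le> G_bound"
    using bound[rule_format, OF F, of 0] bound[rule_format, OF F, of k]
    by (simp add: sum.distrib flip: sum_divide_distrib)
  finally show "(\<Sum>n\<in>F. cmod (G_summand k n t)) \<le> G_bound" .
qed

lemma walnut_G_measurable [measurable]: "walnut_G g a b k \<in> borel_measurable borel"
proof -
  have "(\<lambda>t. \<Sum>\<^sub>\<infinity>n. G_summand k n t) \<in> borel_measurable borel"
    by (rule infsum_int_measurable) measurable
  then show ?thesis by (simp add: walnut_G_def[abs_def])
qed

lemma walnut_G_bounded: "AE t in lborel. cmod (walnut_G g a b k t) \<le> G_bound"
  using G_summand_sum_le
proof eventually_elim
  case (elim t)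
  have sum: "(\<lambda>n. cmod (G_summand k n t)) summable_on UNIV"
    by (rule nonneg_bounded_partial_sums_imp_summable_on[where C = G_bound])
      (use elim in \<open>auto intro!: eventually_finite_subsets_at_top_weakI\<close>)
  have "cmod (walnut_G g a b k t) \<le> (\<Sum>\<^sub>\<infinity>n. cmod (G_summand k n t))"
    unfolding walnut_G_def by (rule norm_infsum_bound[OF sum])
  also have "\<dots> \<le> G_bound"
    by (rule infsum_le_finite_sums[OF sum]) (use elim in auto)
  finally show ?case .
qed

lemma walnut_term_eq: "walnut_term g a b f k t = f (t - of_int k / b) * walnut_G g a b k t"
  by (simp add: walnut_term_def translation_def)

lemma
  assumes f: "f \<in> L2"
  shows walnut_term_L2: "walnut_term g a b f k \<in> L2"
    and walnut_term_norm_le: "l2_norm (walnut_term g a b f k) \<le> G_bound * l2_norm f"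
proof -
  have fk: "(\<lambda>t. f (t - of_int k / b)) \<in> L2" by (rule L2_translate[OF f])
  then have [measurable]: "(\<lambda>t. f (t - of_int k / b)) \<in> borel_measurable borel"
    using L2_measurable by force
  have AE: "AE t in lborel. cmod (walnut_term g a b f k t) \<le> G_bound * cmod (f (t - of_int k / b))"
    using walnut_G_bounded[of k]
  proof eventually_elim
    case (elim t)
    from mult_right_mono[OF this norm_ge_zero[of "f (t - of_int k / b)"]]
    show ?case by (simp add: walnut_term_eq norm_mult mult.commute)
  qed
  show L2: "walnut_term g a b f k \<in> L2"
    by (rule L2_dominated[OF fk _ AE]) (simp add: walnut_term_eq[abs_def])
  have "l2_norm (walnut_term g a b f k) \<le> G_bound * l2_norm (\<lambda>t. f (t - of_int k / b))"
    by (rule l2_norm_mono[OF fk L2 AE G_bound_nonneg])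
  also have "l2_norm (\<lambda>t. f (t - of_int k / b)) = l2_norm f"
    unfolding l2_norm_def using integral_translate[of "\<lambda>t. (cmod (f t))\<^sup>2" "of_int k / b"] by simp
  finally show "l2_norm (walnut_term g a b f k) \<le> G_bound * l2_norm f" .
qed

lemma
  assumes f: "f \<in> L2"
  shows frame_operator_L2: "frame_operator g a b f \<in> L2"
    and frame_operator_has_sum: "h \<in> L2 \<Longrightarrow>
      ((\<lambda>p. l2_inner f (wh g a b p) * cnj (l2_inner h (wh g a b p)))
        has_sum l2_inner (frame_operator g a b f) h) UNIV"
proof -
  have "\<exists>u. l2_has_sum (\<lambda>p t. l2_inner f (wh g a b p) * wh g a b p t) u"
    by (rule Bessel_synthesis[OF wh_L2 coeff_sum_le coeff_summable[OF f]])
  then have S: "l2_has_sum (\<lambda>p t. l2_inner f (wh g a b p) * wh g a b p t) (frame_operator g a b f)"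
    unfolding frame_operator_def by (rule someI_ex)
  then show "frame_operator g a b f \<in> L2" by (simp add: l2_has_sum_def)
  show "((\<lambda>p. l2_inner f (wh g a b p) * cnj (l2_inner h (wh g a b p)))
        has_sum l2_inner (frame_operator g a b f) h) UNIV" if "h \<in> L2"
    using l2_has_sum_inner[OF S that] by (simp add: l2_inner_scale_left l2_inner_cnj[of _ h])
qed

text \<open>
  For fixed \<open>n\<close> the sum over \<open>m\<close> is Parseval's formula for \<open>f\<close> and \<open>h\<close> multiplied by the conjugate of
  \<open>T\<^bsub>na\<^esub> g\<close>; these products are square-integrable because \<open>g\<close> is essentially
  bounded. The sum over \<open>n\<close> can be taken under the integral since \<open>\<Sum>\<^sub>n |g(t - na) g(t - na - k/b)| \<le> bB\<close>.
\<close>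

theorem Walnut_on_windows:
  assumes f: "f \<in> L2" and h: "h \<in> L2"
    and f0: "\<And>t. t \<notin> window b i \<Longrightarrow> f t = 0" and h0: "\<And>t. t \<notin> window b j \<Longrightarrow> h t = 0"
  shows "l2_inner (frame_operator g a b f) h
    = complex_of_real (1 / b) * l2_inner (walnut_term g a b f (j - i)) h"
proof -
  define k where "k = j - i"
  have fk: "(\<lambda>t. f (t - of_int k / b)) \<in> L2" by (rule L2_translate[OF f])
  have [measurable]: "f \<in> borel_measurable borel" "h \<in> borel_measurable borel"
    using L2_measurable[OF f] L2_measurable[OF h] by auto
  have prod: "(\<lambda>t. f' t * cnj (g (t - of_int n * a))) \<in> L2" if f': "f' \<in> L2" for f' n
  proof (rule L2_dominated[OF f', where C = "sqrt G_bound"])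
    have [measurable]: "f' \<in> borel_measurable borel" using L2_measurable[OF f'] by simp
    show "(\<lambda>t. f' t * cnj (g (t - of_int n * a))) \<in> borel_measurable lborel" by simp
    show "AE t in lborel. cmod (f' t * cnj (g (t - of_int n * a))) \<le> sqrt G_bound * cmod (f' t)"
      using square_sum_le[of "{n}", simplified]
    proof eventually_elim
      case (elim t)
      then have "cmod (g (t - of_int n * a)) \<le> sqrt G_bound"
        by (intro real_le_rsqrt) (simp add: mult.commute)
      from mult_right_mono[OF this norm_ge_zero[of "f' t"]] show ?case
        by (simp add: norm_mult mult.commute)
    qed
  qed
  define \<phi> where "\<phi> n t = f (t - of_int k / b) * cnj (h t) * G_summand k n t" for n t
  have inner: "((\<lambda>m. l2_inner f (wh g a b (m, n)) * cnj (l2_inner h (wh g a b (m, n))))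
      has_sum (complex_of_real (1 / b) * (LINT t|lborel. \<phi> n t))) UNIV" for n
  proof -
    have "((\<lambda>m. l2_inner f (wh g a b (m, n)) * cnj (l2_inner h (wh g a b (m, n))))
        has_sum (complex_of_real (1 / b) * (LINT t|lborel.
          f (t - of_int k / b) * cnj (g (t - of_int k / b - of_int n * a)) * cnj (h t * cnj (g (t - of_int n * a)))))) UNIV"
      unfolding inner_wh k_def
      by (rule shifted_window_Parseval[OF b_pos prod[OF f] prod[OF h]]) (use f0 h0 in auto)
    moreover have "f (t - of_int k / b) * cnj (g (t - of_int k / b - of_int n * a)) * cnj (h t * cnj (g (t - of_int n * a)))
        = \<phi> n t" for t
    proof -
      have "t - of_int k / b - of_int n * a = t - of_int n * a - of_int k / b" by simp
      then show ?thesis unfolding \<phi>_def by (simp only: mult_ac complex_cnj_mult complex_cnj_cnj)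
    qed
    ultimately show ?thesis by simp
  qed
  have "((\<lambda>(n, m). l2_inner f (wh g a b (m, n)) * cnj (l2_inner h (wh g a b (m, n))))
      has_sum l2_inner (frame_operator g a b f) h) (UNIV \<times> UNIV)"
    using frame_operator_has_sum[OF f h] has_sum_swap[of _ UNIV UNIV] by fastforce
  from has_sum_SigmaD[OF this] inner
  have "((\<lambda>n. complex_of_real (1 / b) * (LINT t|lborel. \<phi> n t))
      has_sum l2_inner (frame_operator g a b f) h) UNIV" by simp
  moreover have "((\<lambda>n. complex_of_real (1 / b) * (LINT t|lborel. \<phi> n t))
      has_sum (complex_of_real (1 / b) * (LINT t|lborel. (\<Sum>\<^sub>\<infinity>n. \<phi> n t)))) UNIV"
  proof (rule has_sum_cmult_right, rule has_sum_integral_infsum)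
    show "\<phi> n \<in> borel_measurable borel" for n unfolding \<phi>_def by measurable
    show "integrable lborel (\<lambda>t. G_bound * cmod (f (t - of_int k / b) * cnj (h t)))"
      by (intro integrable_mult_right integrable_norm integrable_inner fk h)
    show "AE t in lborel. \<forall>F. finite F \<longrightarrow> (\<Sum>n\<in>F. cmod (\<phi> n t))
        \<le> G_bound * cmod (f (t - of_int k / b) * cnj (h t))"
      using G_summand_sum_le
    proof (eventually_elim, intro allI impI)
      fix t and F :: "int set"
      assume "\<forall>k::int. \<forall>F. finite F \<longrightarrow> (\<Sum>n\<in>F. cmod (G_summand k n t)) \<le> G_bound" "finite F"
      then have "(\<Sum>n\<in>F. cmod (G_summand k n t)) \<le> G_bound" by blast
      then have "cmod (f (t - of_int k / b) * cnj (h t)) * (\<Sum>n\<in>F. cmod (G_summand k n t))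
          \<le> cmod (f (t - of_int k / b) * cnj (h t)) * G_bound" by (rule mult_left_mono) simp
      then show "(\<Sum>n\<in>F. cmod (\<phi> n t)) \<le> G_bound * cmod (f (t - of_int k / b) * cnj (h t))"
        by (simp add: \<phi>_def norm_mult sum_distrib_left mult.commute)
    qed
  qed
  moreover have "(\<Sum>\<^sub>\<infinity>n. \<phi> n t) = walnut_term g a b f k t * cnj (h t)" for t
    unfolding \<phi>_def infsum_cmult_right' walnut_term_eq walnut_G_def by (simp add: mult_ac)
  ultimately show ?thesis
    unfolding k_def[symmetric] l2_inner_def[of "walnut_term _ _ _ _ _"] using has_sum_unique by auto
qed

end

section \<open>Cutting a function into windows\<close>

lemma mem_window_floor: "0 < b \<Longrightarrow> t \<in> window b j \<longleftrightarrow> j = \<lfloor>b * t\<rfloor>"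
  using floor_eq_iff[of "b * t" j] by (auto simp: window_def field_simps)

definition cut :: "real \<Rightarrow> int \<Rightarrow> (real \<Rightarrow> complex) \<Rightarrow> real \<Rightarrow> complex" where
  "cut b j f t = indicator (window b j) t * f t"

lemma cut_L2: "f \<in> L2 \<Longrightarrow> cut b j f \<in> L2"
  using L2_indicator_mult[of f "window b j"] by (simp add: cut_def[abs_def])

lemma cut_outside: "t \<notin> window b j \<Longrightarrow> cut b j f t = 0"
  by (simp add: cut_def)

lemma cut_approximation:
  assumes b: "0 < b" and f: "f \<in> L2" and e: "0 < e"
  shows "\<exists>J. finite J \<and> l2_norm (\<lambda>t. f t - (\<Sum>j\<in>J. cut b j f t)) \<le> e"
proof -
  define J where "J N = {- int N..int N}" for N
  define r where "r N t = f t - (\<Sum>j\<in>J N. cut b j f t)" for N t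
  have r: "r N t = (if \<lfloor>b * t\<rfloor> \<in> J N then 0 else f t)" for N t
  proof -
    have "(\<Sum>j\<in>J N. cut b j f t) = (\<Sum>j\<in>J N. if j = \<lfloor>b * t\<rfloor> then f t else 0)"
      by (intro sum.cong) (auto simp: cut_def mem_window_floor[OF b])
    then show ?thesis by (simp add: r_def J_def)
  qed
  have rL: "r N \<in> L2" for N
    unfolding r_def by (intro L2_diff L2_sum f cut_L2)
  have [measurable]: "r N \<in> borel_measurable borel" for N
    using L2_measurable[OF rL] by simp
  have "(\<lambda>N. LINT t|lborel. (cmod (r N t))\<^sup>2) \<longlonglongrightarrow> (LINT t::real|lborel. 0)"
  proof (rule integral_dominated_convergence[where w = "\<lambda>t. (cmod (f t))\<^sup>2"])
    show "AE t in lborel. (\<lambda>N. (cmod (r N t))\<^sup>2) \<longlonglongrightarrow> 0"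
    proof (intro AE_I2 tendsto_eventually)
      fix t
      show "\<forall>\<^sub>F N in sequentially. (cmod (r N t))\<^sup>2 = 0"
        using eventually_ge_at_top[of "nat \<bar>\<lfloor>b * t\<rfloor>\<bar>"]
        by eventually_elim (auto simp: r J_def)
    qed
    show "AE t in lborel. norm ((cmod (r N t))\<^sup>2) \<le> (cmod (f t))\<^sup>2" for N
      by (simp add: r)
  qed (use L2_integrable_sq[OF f] in simp_all)
  then have "(\<lambda>N. sqrt (LINT t|lborel. (cmod (r N t))\<^sup>2)) \<longlonglongrightarrow> sqrt 0"
    by (intro tendsto_real_sqrt) simp
  then have "\<forall>\<^sub>F N in sequentially. l2_norm (r N) < e"
    using e unfolding l2_norm_def by (intro order_tendstoD(2)) auto
  then obtain N where "l2_norm (r N) < e"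
    by (auto simp: eventually_sequentially)
  then show ?thesis by (intro exI[of _ "J N"]) (simp add: J_def r_def[abs_def])
qed

text \<open>
  Density of the finite sums of windowed functions, in the form in which it is applied to each
  argument of a bounded form.
\<close>

lemma bounded_additive_zero:
  fixes \<Lambda> :: "(real \<Rightarrow> complex) \<Rightarrow> complex"
  assumes b: "0 < b"
    and add: "\<And>f f'. f \<in> L2 \<Longrightarrow> f' \<in> L2 \<Longrightarrow> \<Lambda> (\<lambda>t. f t + f' t) = \<Lambda> f + \<Lambda> f'"
    and bound: "\<And>f. f \<in> L2 \<Longrightarrow> cmod (\<Lambda> f) \<le> K * l2_norm f"
    and zero: "\<And>f j. f \<in> L2 \<Longrightarrow> (\<And>t. t \<notin> window b j \<Longrightarrow> f t = 0) \<Longrightarrow> \<Lambda> f = 0"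
    and f: "f \<in> L2"
  shows "\<Lambda> f = 0"
proof -
  have cuts_L2: "(\<lambda>t. \<Sum>j\<in>J. cut b j f t) \<in> L2" for J
    by (rule L2_sum) (rule cut_L2[OF f])
  have \<Lambda>_zero: "\<Lambda> (\<lambda>t. 0) = 0"
    by (rule zero[OF L2_zero, of 0]) simp
  have sum0: "\<Lambda> (\<lambda>t. \<Sum>j\<in>J. cut b j f t) = 0" for J
  proof (induction J rule: infinite_finite_induct)
    case (insert j J)
    then show ?case
      using add[OF cut_L2[OF f, of b j] cuts_L2[of J]]
        zero[OF cut_L2[OF f, of b j] cut_outside] by simp
  qed (simp_all add: \<Lambda>_zero)
  have "cmod (\<Lambda> f) \<le> 0 + e" if e: "0 < e" for e
  proof -
    obtain J where J: "l2_norm (\<lambda>t. f t - (\<Sum>j\<in>J. cut b j f t)) \<le> e / (\<bar>K\<bar> + 1)"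
      using cut_approximation[OF b f, of "e / (\<bar>K\<bar> + 1)"] e by auto
    define r where "r t = f t - (\<Sum>j\<in>J. cut b j f t)" for t
    have r: "r \<in> L2" unfolding r_def by (intro L2_diff L2_sum f cut_L2)
    have "\<Lambda> f = \<Lambda> r"
      using add[OF r cuts_L2[of J]] sum0[of J] by (simp add: r_def)
    also have "cmod (\<Lambda> r) \<le> K * l2_norm r" by (rule bound[OF r])
    also have "\<dots> \<le> \<bar>K\<bar> * l2_norm r" by (rule mult_right_mono) auto
    also have "\<dots> \<le> \<bar>K\<bar> * (e / (\<bar>K\<bar> + 1))"
      using J by (intro mult_left_mono) (auto simp: r_def[abs_def])
    also have "\<dots> \<le> e" using e by (simp add: field_simps)
    finally show ?thesis by simp
  qed
  then have "cmod (\<Lambda> f) \<le> 0" by (rule field_le_epsilon)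
  then show ?thesis by simp
qed

lemma has_sum_norm_le:
  fixes x :: "'i \<Rightarrow> complex"
  assumes "(x has_sum s) UNIV" "\<And>F. finite F \<Longrightarrow> cmod (\<Sum>i\<in>F. x i) \<le> K"
  shows "cmod s \<le> K"
proof (rule tendsto_upperbound)
  show "((\<lambda>F. cmod (\<Sum>i\<in>F. x i)) \<longlongrightarrow> cmod s) (finite_subsets_at_top UNIV)"
    using assms(1) unfolding has_sum_def by (rule tendsto_norm)
qed (use assms(2) in \<open>auto intro: eventually_finite_subsets_at_top_weakI\<close>)

section \<open>Partial sums of the Walnut series\<close>

context preframe
begin

abbreviation W :: "(real \<Rightarrow> complex) \<Rightarrow> int \<Rightarrow> real \<Rightarrow> complex" where
  "W f k \<equiv> walnut_term g a b f k"

abbreviation S\<^sub>M :: "int set \<Rightarrow> (real \<Rightarrow> complex) \<Rightarrow> real \<Rightarrow> complex" where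
  "S\<^sub>M M f \<equiv> walnut_partial g a b M f"

lemma walnut_partial_eq: "S\<^sub>M M f = (\<lambda>t. \<Sum>k\<in>M. W f k t)"
  by (simp add: walnut_partial_def[abs_def] walnut_term_eq)

lemma walnut_partial_L2: "f \<in> L2 \<Longrightarrow> S\<^sub>M M f \<in> L2"
  unfolding walnut_partial_eq by (intro L2_sum walnut_term_L2)

lemma W_add: "W (\<lambda>t. f t + f' t) k = (\<lambda>t. W f k t + W f' k t)"
  by (simp add: walnut_term_eq fun_eq_iff distrib_right)

lemma W_scale: "W (\<lambda>t. c * f t) k = (\<lambda>t. c * W f k t)"
  by (simp add: walnut_term_eq fun_eq_iff mult.assoc)

lemma walnut_partial_add: "S\<^sub>M M (\<lambda>t. f t + f' t) = (\<lambda>t. S\<^sub>M M f t + S\<^sub>M M f' t)"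
  by (simp add: walnut_partial_eq W_add sum.distrib)

lemma walnut_partial_scale: "S\<^sub>M M (\<lambda>t. c * f t) = (\<lambda>t. c * S\<^sub>M M f t)"
  by (simp add: walnut_partial_eq W_scale sum_distrib_left)

lemma walnut_partial_bounded:
  assumes "f \<in> L2" shows "l2_norm (S\<^sub>M M f) \<le> (real (card M) * G_bound) * l2_norm f"
proof -
  have "l2_norm (S\<^sub>M M f) \<le> (\<Sum>k\<in>M. l2_norm (W f k))"
    unfolding walnut_partial_eq by (rule l2_norm_sum_le) (rule walnut_term_L2[OF assms])
  also have "\<dots> \<le> (\<Sum>k\<in>M. G_bound * l2_norm f)"
    by (intro sum_mono walnut_term_norm_le assms)
  finally show ?thesis by simp
qed

text \<open>
  Quantifying over all \<open>M\<close> is harmless: a sum over an infinite set is 0 by convention.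
\<close>

definition uniform_bound :: "real \<Rightarrow> bool" where
  "uniform_bound C \<longleftrightarrow> 0 \<le> C \<and> (\<forall>M. \<forall>f\<in>L2. l2_norm (S\<^sub>M M f) \<le> C * l2_norm f)"

lemma uniform_bound_iff:
  "(SUP M\<in>{M. finite M}. l2_opnorm (walnut_partial g a b M)) < \<infinity> \<longleftrightarrow> (\<exists>C. uniform_bound C)"
proof
  assume "(SUP M\<in>{M. finite M}. l2_opnorm (walnut_partial g a b M)) < \<infinity>"
  then obtain n :: nat where n: "(SUP M\<in>{M. finite M}. l2_opnorm (walnut_partial g a b M)) < ereal (real n)"
    using less_PInf_Ex_of_nat by auto
  have fin: "l2_norm (S\<^sub>M M f) \<le> real n * l2_norm f" if M: "finite M" and f: "f \<in> L2" for M f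
  proof -
    have "l2_opnorm (walnut_partial g a b M) < ereal (real n)"
      using M by (intro le_less_trans[OF SUP_upper n]) simp
    then obtain C where C: "C < real n" "\<forall>f\<in>L2. l2_norm (S\<^sub>M M f) \<le> C * l2_norm f"
      unfolding l2_opnorm_def by (auto simp: INF_less_iff)
    have "l2_norm (S\<^sub>M M f) \<le> C * l2_norm f" using C(2) f by blast
    also have "\<dots> \<le> real n * l2_norm f" using C(1) by (intro mult_right_mono) auto
    finally show ?thesis .
  qed
  have "l2_norm (S\<^sub>M M f) \<le> real n * l2_norm f" if "f \<in> L2" for M f
  proof (cases "finite M")
    case False
    then show ?thesis by (simp add: walnut_partial_eq)
  qed (rule fin[OF _ that])
  then have "uniform_bound (real n)" by (simp add: uniform_bound_def)
  then show "\<exists>C. uniform_bound C" by blast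
next
  assume "\<exists>C. uniform_bound C"
  then obtain C where C: "uniform_bound C" by blast
  have "l2_opnorm (walnut_partial g a b M) \<le> ereal C" for M
    unfolding l2_opnorm_def by (rule INF_lower) (use C walnut_partial_L2 in \<open>auto simp: uniform_bound_def\<close>)
  then have "(SUP M\<in>{M. finite M}. l2_opnorm (walnut_partial g a b M)) \<le> ereal C"
    by (intro SUP_least)
  then show "(SUP M\<in>{M. finite M}. l2_opnorm (walnut_partial g a b M)) < \<infinity>"
    by (rule le_less_trans) simp
qed

text \<open>
  The uniform boundedness principle is used twice: for fixed \<open>f\<close> it bounds the functionals
  \<open>\<langle>S\<^sub>M f, \<cdot>\<rangle>\<close>, which bounds \<open>\<parallel>S\<^sub>M f\<parallel>\<close> independently of \<open>M\<close>, and then it bounds the operators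
  \<open>S\<^sub>M\<close>.
\<close>

lemma weakly_summable_imp_uniform_bound:
  assumes summable: "\<And>f h. f \<in> L2 \<Longrightarrow> h \<in> L2 \<Longrightarrow> (\<lambda>k. l2_inner (W f k) h) summable_on UNIV"
  shows "\<exists>C. uniform_bound C"
proof -
  have inner: "l2_inner (S\<^sub>M M f) h = (\<Sum>k\<in>M. l2_inner (W f k) h)" if "f \<in> L2" "h \<in> L2" for M f h
    unfolding walnut_partial_eq by (rule l2_inner_sum_left) (use that walnut_term_L2 in auto)
  have pointwise: "\<exists>K. \<forall>M. l2_norm (S\<^sub>M M f) \<le> K" if f: "f \<in> L2" for f
  proof -
    have "\<exists>K\<ge>0. \<forall>M. \<forall>h\<in>L2. cmod (l2_inner (S\<^sub>M M f) h) \<le> K * l2_norm h"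
    proof (rule uniform_boundedness)
      fix M h h' assume "h \<in> L2" "h' \<in> L2"
      then show "cmod (l2_inner (S\<^sub>M M f) (\<lambda>t. h t + h' t))
          \<le> cmod (l2_inner (S\<^sub>M M f) h) + cmod (l2_inner (S\<^sub>M M f) h')"
        by (simp add: l2_inner_add_right walnut_partial_L2 f norm_triangle_ineq)
    next
      fix M h r assume "h \<in> L2"
      show "cmod (l2_inner (S\<^sub>M M f) (\<lambda>t. complex_of_real r * h t)) = \<bar>r\<bar> * cmod (l2_inner (S\<^sub>M M f) h)"
        by (simp add: l2_inner_scale_right norm_mult)
    next
      fix M
      show "\<exists>C. \<forall>h\<in>L2. cmod (l2_inner (S\<^sub>M M f) h) \<le> C * l2_norm h"
        using l2_Cauchy_Schwarz[OF walnut_partial_L2[OF f]] by blast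
    next
      fix h assume h: "h \<in> L2"
      have sum: "(\<lambda>k. cmod (l2_inner (W f k) h)) summable_on UNIV"
        using summable[OF f h] by (simp add: summable_on_iff_abs_summable_on_complex)
      have "cmod (l2_inner (S\<^sub>M M f) h) \<le> (\<Sum>\<^sub>\<infinity>k. cmod (l2_inner (W f k) h))" for M
      proof (cases "finite M")
        case True
        have "cmod (l2_inner (S\<^sub>M M f) h) \<le> (\<Sum>k\<in>M. cmod (l2_inner (W f k) h))"
          unfolding inner[OF f h] by (rule norm_sum)
        also have "\<dots> \<le> (\<Sum>\<^sub>\<infinity>k. cmod (l2_inner (W f k) h))"
          by (rule finite_sum_le_infsum[OF sum True]) auto
        finally show ?thesis .
      next
        case False
        then show ?thesis unfolding inner[OF f h] by (simp add: infsum_nonneg)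
      qed
      then show "\<exists>K. \<forall>M. cmod (l2_inner (S\<^sub>M M f) h) \<le> K" by blast
    qed
    then obtain K where K: "0 \<le> K" "\<And>M h. h \<in> L2 \<Longrightarrow> cmod (l2_inner (S\<^sub>M M f) h) \<le> K * l2_norm h"
      by blast
    have "l2_norm (S\<^sub>M M f) \<le> K" for M
    proof (cases "l2_norm (S\<^sub>M M f) = 0")
      case False
      (* The functional attains its norm at h = S\<^sub>M f. *)
      have "l2_norm (S\<^sub>M M f) * l2_norm (S\<^sub>M M f) = cmod (l2_inner (S\<^sub>M M f) (S\<^sub>M M f))"
        by (simp add: l2_inner_self norm_power power2_eq_square norm_mult)
      also have "\<dots> \<le> K * l2_norm (S\<^sub>M M f)" by (rule K(2)[OF walnut_partial_L2[OF f]])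
      finally show ?thesis
        using False l2_norm_nonneg[of "S\<^sub>M M f"] by (simp add: mult_le_cancel_right)
    qed (simp add: K)
    then show ?thesis by blast
  qed
  have "\<exists>C\<ge>0. \<forall>M. \<forall>f\<in>L2. l2_norm (S\<^sub>M M f) \<le> C * l2_norm f"
  proof (rule uniform_boundedness)
    fix M f f' assume "f \<in> L2" "f' \<in> L2"
    then show "l2_norm (S\<^sub>M M (\<lambda>t. f t + f' t)) \<le> l2_norm (S\<^sub>M M f) + l2_norm (S\<^sub>M M f')"
      unfolding walnut_partial_add by (intro l2_norm_triangle walnut_partial_L2)
  next
    fix M f r assume "f \<in> L2"
    show "l2_norm (S\<^sub>M M (\<lambda>t. complex_of_real r * f t)) = \<bar>r\<bar> * l2_norm (S\<^sub>M M f)"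
      unfolding walnut_partial_scale l2_norm_scale by simp
  next
    fix M show "\<exists>C. \<forall>f\<in>L2. l2_norm (S\<^sub>M M f) \<le> C * l2_norm f"
      using walnut_partial_bounded by blast
  qed (rule pointwise)
  then show ?thesis by (auto simp: uniform_bound_def)
qed

text \<open>
  The Cauchy criterion for the net of partial sums of the Walnut series of \<open>f\<close>.
\<close>

definition tail_small :: "(real \<Rightarrow> complex) \<Rightarrow> bool" where
  "tail_small f \<longleftrightarrow> (\<forall>e>0. \<exists>F0. finite F0 \<and>
     (\<forall>F. finite F \<and> F \<inter> F0 = {} \<longrightarrow> l2_norm (S\<^sub>M F f) \<le> e))"

lemma tail_smallD:
  "tail_small f \<Longrightarrow> 0 < e \<Longrightarrow> \<exists>F0. finite F0 \<and>
     (\<forall>F. finite F \<and> F \<inter> F0 = {} \<longrightarrow> l2_norm (S\<^sub>M F f) \<le> e)"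
  by (simp add: tail_small_def)

lemma tail_small_add:
  assumes "f \<in> L2" "f' \<in> L2" "tail_small f" "tail_small f'"
  shows "tail_small (\<lambda>t. f t + f' t)"
  unfolding tail_small_def
proof (intro allI impI)
  fix e :: real assume "0 < e"
  then have e2: "0 < e / 2" by simp
  obtain F0 where F0: "finite F0"
    "\<And>F. finite F \<Longrightarrow> F \<inter> F0 = {} \<Longrightarrow> l2_norm (S\<^sub>M F f) \<le> e / 2"
    using tail_smallD[OF assms(3) e2] by auto
  obtain F1 where F1: "finite F1"
    "\<And>F. finite F \<Longrightarrow> F \<inter> F1 = {} \<Longrightarrow> l2_norm (S\<^sub>M F f') \<le> e / 2"
    using tail_smallD[OF assms(4) e2] by auto
  have "l2_norm (S\<^sub>M F (\<lambda>t. f t + f' t)) \<le> e" if F: "finite F" "F \<inter> (F0 \<union> F1) = {}" for F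
  proof -
    have "F \<inter> F0 = {}" "F \<inter> F1 = {}" using F(2) by auto
    then have "l2_norm (S\<^sub>M F f) \<le> e / 2" "l2_norm (S\<^sub>M F f') \<le> e / 2"
      using F0(2)[OF F(1)] F1(2)[OF F(1)] by blast+
    then show ?thesis
      using l2_norm_triangle[OF walnut_partial_L2 walnut_partial_L2, OF assms(1,2), of F F]
      unfolding walnut_partial_add by simp
  qed
  then show "\<exists>F0. finite F0 \<and> (\<forall>F. finite F \<and> F \<inter> F0 = {} \<longrightarrow> l2_norm (S\<^sub>M F (\<lambda>t. f t + f' t)) \<le> e)"
    using F0(1) F1(1) by (intro exI[of _ "F0 \<union> F1"]) auto
qed

lemma W_support:
  assumes "\<And>t. t \<notin> window b j \<Longrightarrow> f t = 0" "t \<notin> window b (j + k)"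
  shows "W f k t = 0"
proof -
  have "t - of_int k / b \<notin> window b j"
    using assms(2) by (auto simp: window_def add_divide_distrib)
  then show ?thesis by (simp add: walnut_term_eq assms(1))
qed

text \<open>
  At each point at most one term is nonzero, because distinct terms live on distinct windows.
\<close>

lemma walnut_partial_Pythagoras:
  assumes f: "f \<in> L2" and f0: "\<And>t. t \<notin> window b j \<Longrightarrow> f t = 0" and M: "finite M"
  shows "(l2_norm (S\<^sub>M M f))\<^sup>2 = (\<Sum>k\<in>M. (l2_norm (W f k))\<^sup>2)"
proof -
  have "(cmod (S\<^sub>M M f t))\<^sup>2 = (\<Sum>k\<in>M. (cmod (W f k t))\<^sup>2)" for t
  proof -
    have W0: "W f k t = 0" if "k \<noteq> \<lfloor>b * t\<rfloor> - j" for k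
      using that by (intro W_support[OF f0]) (auto simp: mem_window_floor[OF b_pos])
    have 1: "(\<Sum>k\<in>M. W f k t) = (\<Sum>k\<in>M. if k = \<lfloor>b * t\<rfloor> - j then W f (\<lfloor>b * t\<rfloor> - j) t else 0)"
      by (intro sum.cong) (auto simp: W0)
    have 2: "(\<Sum>k\<in>M. (cmod (W f k t))\<^sup>2)
        = (\<Sum>k\<in>M. if k = \<lfloor>b * t\<rfloor> - j then (cmod (W f (\<lfloor>b * t\<rfloor> - j) t))\<^sup>2 else 0)"
      by (intro sum.cong) (auto simp: W0)
    show ?thesis unfolding walnut_partial_eq 1 2 using M by simp
  qed
  then show ?thesis
    unfolding l2_norm_sq
    by (simp add: Bochner_Integration.integral_sum[OF L2_integrable_sq[OF walnut_term_L2[OF f]]])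
qed

text \<open>
  By orthogonality the uniform bound says that the squared norms of the terms are summable.
\<close>

lemma tail_small_window:
  assumes C: "uniform_bound C" and f: "f \<in> L2" and f0: "\<And>t. t \<notin> window b j \<Longrightarrow> f t = 0"
  shows "tail_small f"
  unfolding tail_small_def
proof (intro allI impI)
  fix e :: real assume e: "0 < e"
  have "(\<lambda>k. (l2_norm (W f k))\<^sup>2) summable_on UNIV"
  proof (rule nonneg_bounded_partial_sums_imp_summable_on)
    show "\<forall>\<^sub>F M in finite_subsets_at_top UNIV. (\<Sum>k\<in>M. (l2_norm (W f k))\<^sup>2) \<le> (C * l2_norm f)\<^sup>2"
    proof (rule eventually_finite_subsets_at_top_weakI)
      fix M :: "int set" assume "finite M"
      then have "(\<Sum>k\<in>M. (l2_norm (W f k))\<^sup>2) = (l2_norm (S\<^sub>M M f))\<^sup>2"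
        using walnut_partial_Pythagoras[OF f f0] by simp
      also have "\<dots> \<le> (C * l2_norm f)\<^sup>2"
        using C f by (intro power_mono) (auto simp: uniform_bound_def)
      finally show "(\<Sum>k\<in>M. (l2_norm (W f k))\<^sup>2) \<le> (C * l2_norm f)\<^sup>2" .
    qed
  qed simp
  from nonneg_summable_tail[OF this, of "e\<^sup>2"] e obtain F0 where F0: "finite F0"
    "\<And>F. finite F \<Longrightarrow> F \<inter> F0 = {} \<Longrightarrow> (\<Sum>k\<in>F. (l2_norm (W f k))\<^sup>2) \<le> e\<^sup>2"
    by auto
  have "l2_norm (S\<^sub>M F f) \<le> e" if "finite F" "F \<inter> F0 = {}" for F
  proof (rule power2_le_imp_le)
    show "(l2_norm (S\<^sub>M F f))\<^sup>2 \<le> e\<^sup>2"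
      using F0(2)[OF that] walnut_partial_Pythagoras[OF f f0 that(1)] by simp
  qed (use e in simp)
  then show "\<exists>F0. finite F0 \<and> (\<forall>F. finite F \<and> F \<inter> F0 = {} \<longrightarrow> l2_norm (S\<^sub>M F f) \<le> e)"
    using F0(1) by blast
qed

text \<open>
  Split \<open>f\<close> into a finite sum of windowed functions and a remainder of small norm; the uniform bound
  keeps the contribution of the remainder small for every \<open>F\<close>.
\<close>

lemma tail_small_all:
  assumes C: "uniform_bound C" and f: "f \<in> L2"
  shows "tail_small f"
proof -
  have cuts_L2: "(\<lambda>t. \<Sum>j\<in>J. cut b j f t) \<in> L2" for J
    by (rule L2_sum) (rule cut_L2[OF f])
  have tail_zero: "tail_small (\<lambda>t. 0)"
    by (rule tail_small_window[OF C L2_zero, of 0]) simp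
  have cuts: "tail_small (\<lambda>t. \<Sum>j\<in>J. cut b j f t)" for J
  proof (induction J rule: infinite_finite_induct)
    case (insert j J)
    then show ?case
      using tail_small_add[OF cut_L2[OF f, of b j] cuts_L2[of J]]
        tail_small_window[OF C cut_L2[OF f] cut_outside, of j] by simp
  qed (simp_all add: tail_zero)
  have C0: "0 \<le> C" using C by (simp add: uniform_bound_def)
  show ?thesis
    unfolding tail_small_def
  proof (intro allI impI)
    fix e :: real assume e: "0 < e"
    (* C + 1 rather than C, which may be 0. *)
    then have "0 < e / 2 / (C + 1)" using C0 by simp
    from cut_approximation[OF b_pos f this] obtain J
      where J: "l2_norm (\<lambda>t. f t - (\<Sum>j\<in>J. cut b j f t)) \<le> e / 2 / (C + 1)" by blast
    define p where "p t = (\<Sum>j\<in>J. cut b j f t)" for t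
    have p: "p \<in> L2" unfolding p_def by (intro L2_sum f cut_L2)
    have r: "(\<lambda>t. f t - p t) \<in> L2" by (rule L2_diff[OF f p])
    have e2: "0 < e / 2" using e by simp
    obtain F0 where F0: "finite F0"
      "\<And>F. finite F \<Longrightarrow> F \<inter> F0 = {} \<Longrightarrow> l2_norm (S\<^sub>M F p) \<le> e / 2"
      using tail_smallD[OF cuts[of J, folded p_def[abs_def]] e2] by auto
    have "l2_norm (S\<^sub>M F f) \<le> e" if F: "finite F" "F \<inter> F0 = {}" for F
    proof -
      have "l2_norm (S\<^sub>M F f) \<le> l2_norm (S\<^sub>M F p) + l2_norm (S\<^sub>M F (\<lambda>t. f t - p t))"
        using l2_norm_triangle[OF walnut_partial_L2[OF p] walnut_partial_L2[OF r], of F F]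
        unfolding walnut_partial_add[symmetric] by simp
      moreover have "l2_norm (S\<^sub>M F (\<lambda>t. f t - p t)) \<le> C * l2_norm (\<lambda>t. f t - p t)"
        using C r unfolding uniform_bound_def by blast
      moreover have "C * l2_norm (\<lambda>t. f t - p t) \<le> C * (e / 2 / (C + 1))"
        using J C0 by (intro mult_left_mono) (auto simp: p_def)
      moreover have "C * (e / 2 / (C + 1)) \<le> e / 2"
        using C0 e by (simp add: field_simps)
      ultimately show ?thesis using F0(2)[OF F] by linarith
    qed
    then show "\<exists>F0. finite F0 \<and> (\<forall>F. finite F \<and> F \<inter> F0 = {} \<longrightarrow> l2_norm (S\<^sub>M F f) \<le> e)"
      using F0(1) by blast
  qed
qed

lemma uniform_bound_imp_norm_sum:
  assumes "uniform_bound C" "f \<in> L2"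
  shows "\<exists>u. l2_has_sum (W f) u"
proof (rule l2_has_sum_Cauchy)
  show "\<exists>F0. finite F0 \<and> (\<forall>F. finite F \<and> F \<inter> F0 = {} \<longrightarrow> l2_norm (\<lambda>t. \<Sum>k\<in>F. W f k t) \<le> e)"
    if "0 < e" for e
    using tail_small_all[OF assms] that unfolding tail_small_def walnut_partial_eq by blast
qed (rule walnut_term_L2[OF assms(2)])

lemma frame_operator_bound:
  assumes f: "f \<in> L2" and h: "h \<in> L2"
  shows "cmod (l2_inner (frame_operator g a b f) h) \<le> frame_bound * l2_norm f * l2_norm h"
proof (rule has_sum_norm_le[OF frame_operator_has_sum[OF f h]])
  fix P :: "(int \<times> int) set" assume P: "finite P"
  let ?c = "\<lambda>f p. cmod (l2_inner f (wh g a b p))"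
  show "cmod (\<Sum>p\<in>P. l2_inner f (wh g a b p) * cnj (l2_inner h (wh g a b p)))
      \<le> frame_bound * l2_norm f * l2_norm h"
  proof (rule power2_le_imp_le)
    have "(cmod (\<Sum>p\<in>P. l2_inner f (wh g a b p) * cnj (l2_inner h (wh g a b p))))\<^sup>2
        \<le> (\<Sum>p\<in>P. ?c f p * ?c h p)\<^sup>2"
      using norm_sum[of "\<lambda>p. l2_inner f (wh g a b p) * cnj (l2_inner h (wh g a b p))" P]
      by (intro power_mono) (auto simp: norm_mult)
    also have "\<dots> \<le> (\<Sum>p\<in>P. (?c f p)\<^sup>2) * (\<Sum>p\<in>P. (?c h p)\<^sup>2)"
      by (rule Cauchy_Schwarz_ineq_sum)
    also have "\<dots> \<le> (frame_bound * (l2_norm f)\<^sup>2) * (frame_bound * (l2_norm h)\<^sup>2)"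
      using frame_bound_nonneg by (intro mult_mono coeff_sum_le f h P sum_nonneg) auto
    also have "\<dots> = (frame_bound * l2_norm f * l2_norm h)\<^sup>2"
      by (simp add: power_mult_distrib power2_eq_square mult_ac)
    finally show "(cmod (\<Sum>p\<in>P. l2_inner f (wh g a b p) * cnj (l2_inner h (wh g a b p))))\<^sup>2
        \<le> (frame_bound * l2_norm f * l2_norm h)\<^sup>2" .
  qed (simp add: frame_bound_nonneg)
qed

lemma frame_operator_inner_add:
  assumes "f \<in> L2" "f' \<in> L2" "h \<in> L2"
  shows "l2_inner (frame_operator g a b (\<lambda>t. f t + f' t)) h
    = l2_inner (frame_operator g a b f) h + l2_inner (frame_operator g a b f') h"
proof (rule has_sum_unique[OF frame_operator_has_sum[OF L2_add[OF assms(1,2)] assms(3)]])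
  show "((\<lambda>p. l2_inner (\<lambda>t. f t + f' t) (wh g a b p) * cnj (l2_inner h (wh g a b p)))
      has_sum (l2_inner (frame_operator g a b f) h + l2_inner (frame_operator g a b f') h)) UNIV"
    using has_sum_add[OF frame_operator_has_sum[OF assms(1,3)] frame_operator_has_sum[OF assms(2,3)]]
    by (simp add: l2_inner_add_left assms wh_L2 distrib_right)
qed

text \<open>
  The difference \<open>\<Phi>\<close> of the two forms is additive and bounded in each argument, so it suffices to
  check windowed \<open>f\<close> and \<open>h\<close>. For these a single term of the Walnut series meets the support of \<open>h\<close>.
\<close>

theorem uniform_bound_imp_Walnut_representation:
  assumes C: "uniform_bound C" and f: "f \<in> L2" and h: "h \<in> L2"
  shows "((\<lambda>k. complex_of_real (1 / b) * l2_inner (W f k) h)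
    has_sum l2_inner (frame_operator g a b f) h) UNIV"
proof -
  define T where "T f = (SOME u. l2_has_sum (W f) u)" for f
  have T: "l2_has_sum (W f) (T f)" if "f \<in> L2" for f
    unfolding T_def using someI_ex[OF uniform_bound_imp_norm_sum[OF C that]] .
  have TL: "T f \<in> L2" if "f \<in> L2" for f using T[OF that] by (simp add: l2_has_sum_def)
  have T_sum: "((\<lambda>k. l2_inner (W f k) h) has_sum l2_inner (T f) h) UNIV" if "f \<in> L2" "h \<in> L2" for f h
    using l2_has_sum_inner[OF T that(2)] that by simp
  have T_add: "l2_inner (T (\<lambda>t. f t + f' t)) h = l2_inner (T f) h + l2_inner (T f') h"
    if "f \<in> L2" "f' \<in> L2" "h \<in> L2" for f f' h
  proof (rule has_sum_unique[OF T_sum[OF L2_add[OF that(1,2)] that(3)]])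
    show "((\<lambda>k. l2_inner (W (\<lambda>t. f t + f' t) k) h) has_sum (l2_inner (T f) h + l2_inner (T f') h)) UNIV"
      using has_sum_add[OF T_sum[OF that(1,3)] T_sum[OF that(2,3)]]
      by (simp add: W_add l2_inner_add_left walnut_term_L2 that)
  qed
  have T_bound: "cmod (l2_inner (T f) h) \<le> C * l2_norm f * l2_norm h" if "f \<in> L2" "h \<in> L2" for f h
  proof (rule has_sum_norm_le[OF T_sum[OF that]])
    fix F :: "int set"
    have "(\<Sum>k\<in>F. l2_inner (W f k) h) = l2_inner (S\<^sub>M F f) h"
      unfolding walnut_partial_eq by (rule l2_inner_sum_left[symmetric]) (use that walnut_term_L2 in auto)
    also have "cmod \<dots> \<le> l2_norm (S\<^sub>M F f) * l2_norm h"
      by (rule l2_Cauchy_Schwarz[OF walnut_partial_L2]) (use that in auto)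
    also have "\<dots> \<le> C * l2_norm f * l2_norm h"
      using C that by (intro mult_right_mono) (auto simp: uniform_bound_def)
    finally show "cmod (\<Sum>k\<in>F. l2_inner (W f k) h) \<le> C * l2_norm f * l2_norm h" .
  qed
  define \<Phi> where "\<Phi> f h = complex_of_real (1 / b) * l2_inner (T f) h - l2_inner (frame_operator g a b f) h" for f h
  define K where "K = 1 / b * C + frame_bound"
  have \<Phi>_bound: "cmod (\<Phi> f h) \<le> K * l2_norm f * l2_norm h" if "f \<in> L2" "h \<in> L2" for f h
  proof -
    have "cmod (\<Phi> f h) \<le> 1 / b * cmod (l2_inner (T f) h) + cmod (l2_inner (frame_operator g a b f) h)"
      unfolding \<Phi>_def using b_pos norm_triangle_ineq4[of "complex_of_real (1 / b) * l2_inner (T f) h" "l2_inner (frame_operator g a b f) h"]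
      by (simp add: norm_mult norm_divide)
    also have "\<dots> \<le> 1 / b * (C * l2_norm f * l2_norm h) + frame_bound * l2_norm f * l2_norm h"
      using b_pos by (intro add_mono mult_left_mono T_bound frame_operator_bound that) auto
    also have "\<dots> = K * l2_norm f * l2_norm h" by (simp add: K_def distrib_right)
    finally show ?thesis .
  qed
  have \<Phi>_windows: "\<Phi> f h = 0" if "f \<in> L2" "h \<in> L2"
    "\<And>t. t \<notin> window b i \<Longrightarrow> f t = 0" "\<And>t. t \<notin> window b j \<Longrightarrow> h t = 0" for f h i j
  proof -
    have "((\<lambda>k. l2_inner (W f k) h) has_sum l2_inner (W f (j - i)) h) UNIV"
    proof (rule has_sum_finite_neutralI[of "{j - i}"])
      fix k assume k: "k \<in> UNIV - {j - i}"
      have prod0: "W f k t * cnj (h t) = 0" for t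
      proof (cases "t \<in> window b j")
        case True
        then have "t \<notin> window b (i + k)" using k by (auto simp: mem_window_floor[OF b_pos])
        then show ?thesis using W_support[OF that(3)] by simp
      qed (simp add: that(4))
      show "l2_inner (W f k) h = 0"
        unfolding l2_inner_def prod0 by simp
    qed auto
    with T_sum[OF that(1,2)] have "l2_inner (T f) h = l2_inner (W f (j - i)) h"
      by (rule has_sum_unique)
    then show ?thesis unfolding \<Phi>_def using Walnut_on_windows[OF that] by simp
  qed
  have \<Phi>_left: "\<Phi> f h = 0" if f: "f \<in> L2" and h: "h \<in> L2" "\<And>t. t \<notin> window b j \<Longrightarrow> h t = 0" for f h j
  proof (rule bounded_additive_zero[OF b_pos, where \<Lambda> = "\<lambda>f. \<Phi> f h" and K = "K * l2_norm h"])
    show "\<Phi> (\<lambda>t. f t + f' t) h = \<Phi> f h + \<Phi> f' h" if "f \<in> L2" "f' \<in> L2" for f f'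
      using that h by (simp add: \<Phi>_def T_add frame_operator_inner_add distrib_left)
    show "cmod (\<Phi> f h) \<le> K * l2_norm h * l2_norm f" if "f \<in> L2" for f
      using \<Phi>_bound[OF that h(1)] by (simp add: mult_ac)
    show "\<Phi> f h = 0" if "f \<in> L2" "\<And>t. t \<notin> window b i \<Longrightarrow> f t = 0" for f i
      by (rule \<Phi>_windows[OF that(1) h(1) that(2) h(2)])
  qed (rule f)
  have "\<Phi> f h = 0"
  proof (rule bounded_additive_zero[OF b_pos, where \<Lambda> = "\<Phi> f" and K = "K * l2_norm f"])
    show "\<Phi> f (\<lambda>t. h t + h' t) = \<Phi> f h + \<Phi> f h'" if "h \<in> L2" "h' \<in> L2" for h h'
      using that f by (simp add: \<Phi>_def l2_inner_add_right TL frame_operator_L2 distrib_left)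
  qed (use \<Phi>_bound[OF f] \<Phi>_left[OF f] h in auto)
  then show ?thesis
    using has_sum_cmult_right[OF T_sum[OF f h], of "complex_of_real (1 / b)"] by (simp add: \<Phi>_def)
qed

text \<open>
  Polarization: \<open>4 \<langle>W f k, h\<rangle>\<close> is the sum of \<open>c \<langle>W (f + c h) k, f + c h\<rangle>\<close> over the four fourth
  roots of unity \<open>c\<close>.
\<close>

lemma quadratic_imp_weakly_summable:
  assumes quad: "\<And>f. f \<in> L2 \<Longrightarrow> (\<lambda>k. l2_inner (W f k) f) summable_on UNIV"
    and f: "f \<in> L2" and h: "h \<in> L2"
  shows "(\<lambda>k. l2_inner (W f k) h) summable_on UNIV"
proof -
  let ?q = "\<lambda>c k. l2_inner (W (\<lambda>t. f t + c * h t) k) (\<lambda>t. f t + c * h t)"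
  have expand: "?q c k = l2_inner (W f k) f + cnj c * l2_inner (W f k) h
      + c * l2_inner (W h k) f + c * cnj c * l2_inner (W h k) h" for c k
    using f h
    by (simp add: W_add W_scale l2_inner_add_left l2_inner_add_right L2_add L2_scale walnut_term_L2
        l2_inner_scale_left l2_inner_scale_right algebra_simps)
  have "l2_inner (W f k) h = 1 / 4 * (?q 1 k + \<i> * ?q \<i> k + (-1) * ?q (-1) k + (-\<i>) * ?q (-\<i>) k)" for k
    unfolding expand by (simp add: algebra_simps)
  moreover have "(\<lambda>k. ?q c k) summable_on UNIV" for c
    by (intro quad L2_add L2_scale f h)
  ultimately show ?thesis
    by (simp only:) (intro summable_on_cmult_right summable_on_add)
qed

lemma frame_operator_self:
  "f \<in> L2 \<Longrightarrow> l2_inner (frame_operator g a b f) f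
    = complex_of_real (\<Sum>\<^sub>\<infinity>p. (cmod (l2_inner f (wh g a b p)))\<^sup>2)"
proof -
  assume f: "f \<in> L2"
  have "((\<lambda>p. complex_of_real ((cmod (l2_inner f (wh g a b p)))\<^sup>2))
      has_sum l2_inner (frame_operator g a b f) f) UNIV"
    using frame_operator_has_sum[OF f f] unfolding complex_norm_square .
  moreover have "((\<lambda>p. complex_of_real ((cmod (l2_inner f (wh g a b p)))\<^sup>2))
      has_sum complex_of_real (\<Sum>\<^sub>\<infinity>p. (cmod (l2_inner f (wh g a b p)))\<^sup>2)) UNIV"
    unfolding has_sum_of_real_iff by (rule has_sum_infsum[OF coeff_summable[OF f]])
  ultimately show ?thesis by (rule has_sum_unique)
qed

lemma frame_identity_iff:
  assumes f: "f \<in> L2"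
  shows "((\<lambda>k. complex_of_real (1 / b) * l2_inner (W f k) f)
      has_sum l2_inner (frame_operator g a b f) f) UNIV
    \<longleftrightarrow> (\<lambda>k. LINT t|lborel. cnj (f t) * f (t - of_int k / b) * walnut_G g a b k t) summable_on UNIV \<and>
      complex_of_real (\<Sum>\<^sub>\<infinity>p. (cmod (l2_inner f (wh g a b p)))\<^sup>2) = complex_of_real (1 / b) *
        (\<Sum>\<^sub>\<infinity>k. LINT t|lborel. cnj (f t) * f (t - of_int k / b) * walnut_G g a b k t)"
proof -
  have inner: "(LINT t|lborel. cnj (f t) * f (t - of_int k / b) * walnut_G g a b k t) = l2_inner (W f k) f" for k
    unfolding l2_inner_def walnut_term_eq by (simp add: mult_ac)
  show ?thesis
    unfolding inner frame_operator_self[OF f, symmetric]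
  proof
    assume sum: "((\<lambda>k. complex_of_real (1 / b) * l2_inner (W f k) f)
      has_sum l2_inner (frame_operator g a b f) f) UNIV"
    then have "((\<lambda>k. l2_inner (W f k) f)
        has_sum (l2_inner (frame_operator g a b f) f / complex_of_real (1 / b))) UNIV"
      using b_pos by (subst (asm) has_sum_cmult_right_iff) auto
    then show "(\<lambda>k. l2_inner (W f k) f) summable_on UNIV \<and> l2_inner (frame_operator g a b f) f
        = complex_of_real (1 / b) * (\<Sum>\<^sub>\<infinity>k. l2_inner (W f k) f)"
      using b_pos by (auto simp: summable_on_def infsumI)
  next
    assume "(\<lambda>k. l2_inner (W f k) f) summable_on UNIV \<and> l2_inner (frame_operator g a b f) f
        = complex_of_real (1 / b) * (\<Sum>\<^sub>\<infinity>k. l2_inner (W f k) f)"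
    then show "((\<lambda>k. complex_of_real (1 / b) * l2_inner (W f k) f)
      has_sum l2_inner (frame_operator g a b f) f) UNIV"
      using has_sum_cmult_right[OF has_sum_infsum] by metis
  qed
qed

end

section \<open>The equivalence\<close>

theorem theorem5p9:
  fixes a b :: real and g :: "real \<Rightarrow> complex"
  assumes "a > 0" and "b > 0" and "g \<in> L2" and "g \<in> PF a b"
  shows
    "((\<forall>f\<in>L2. \<exists>u. l2_has_weak_sum
          (\<lambda>k t. complex_of_real (1 / b) * walnut_term g a b f k t) u)
      \<longleftrightarrow>
      (\<forall>f\<in>L2. \<exists>u. l2_has_sum
          (\<lambda>k t. complex_of_real (1 / b) * walnut_term g a b f k t) u))
   \<and> ((\<forall>f\<in>L2. \<exists>u. l2_has_sum
          (\<lambda>k t. complex_of_real (1 / b) * walnut_term g a b f k t) u)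
      \<longleftrightarrow>
      (SUP M\<in>{M. finite M}. l2_opnorm (walnut_partial g a b M)) < \<infinity>)
   \<and> ((SUP M\<in>{M. finite M}. l2_opnorm (walnut_partial g a b M)) < \<infinity>
      \<longleftrightarrow>
      (\<forall>f\<in>L2. ((\<lambda>k. complex_of_real (1 / b) * l2_inner (walnut_term g a b f k) f)
          has_sum l2_inner (frame_operator g a b f) f) UNIV))
   \<and> ((\<forall>f\<in>L2. ((\<lambda>k. complex_of_real (1 / b) * l2_inner (walnut_term g a b f k) f)
          has_sum l2_inner (frame_operator g a b f) f) UNIV)
      \<longleftrightarrow>
      (\<forall>f\<in>L2.
          (\<lambda>k. LINT t|lborel. cnj (f t) * f (t - of_int k / b) * walnut_G g a b k t)
            summable_on UNIV \<and>
          complex_of_real (\<Sum>\<^sub>\<infinity>p. (cmod (l2_inner f (wh g a b p)))\<^sup>2) =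
          complex_of_real (1 / b) *
            (\<Sum>\<^sub>\<infinity>k. LINT t|lborel. cnj (f t) * f (t - of_int k / b) * walnut_G g a b k t)))"
    (is "(?weak \<longleftrightarrow> ?norm) \<and> (?norm \<longleftrightarrow> ?unif) \<and> (?unif \<longleftrightarrow> ?quad) \<and> (?quad \<longleftrightarrow> ?ident)")
proof -
  interpret preframe a b g using assms by unfold_locales
  have scaled: "x summable_on UNIV" if "(\<lambda>k. complex_of_real (1 / b) * x k) summable_on UNIV"
    for x :: "int \<Rightarrow> complex"
    using summable_on_cmult_right[OF that, of "complex_of_real b"] b_pos by simp
  have weak_unif: "?unif" if weak: "?weak"
    unfolding uniform_bound_iff
  proof (rule weakly_summable_imp_uniform_bound, rule scaled)
    fix f h assume "f \<in> L2" "h \<in> L2"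
    then obtain u where "((\<lambda>k. l2_inner (\<lambda>t. complex_of_real (1 / b) * walnut_term g a b f k t) h)
        has_sum l2_inner u h) UNIV"
      using weak unfolding l2_has_weak_sum_def by blast
    then show "(\<lambda>k. complex_of_real (1 / b) * l2_inner (walnut_term g a b f k) h) summable_on UNIV"
      unfolding l2_inner_scale_left by (auto simp: summable_on_def)
  qed
  have unif_norm: "?norm" if "?unif"
  proof
    fix f assume "f \<in> L2"
    moreover obtain C where "uniform_bound C" using \<open>?unif\<close> unfolding uniform_bound_iff by blast
    ultimately obtain u where "l2_has_sum (W f) u" using uniform_bound_imp_norm_sum by blast
    then show "\<exists>u. l2_has_sum (\<lambda>k t. complex_of_real (1 / b) * walnut_term g a b f k t) u"
      using l2_has_sum_scale by blast
  qed
  have norm_weak: "?weak" if "?norm" using that l2_has_sum_imp_weak by blast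
  have unif_quad: "?quad" if "?unif"
    using that uniform_bound_imp_Walnut_representation unfolding uniform_bound_iff by blast
  have quad_unif: "?unif" if quad: "?quad"
    unfolding uniform_bound_iff
  proof (rule weakly_summable_imp_uniform_bound, rule quadratic_imp_weakly_summable, rule scaled)
    fix f assume "f \<in> L2"
    with quad show "(\<lambda>k. complex_of_real (1 / b) * l2_inner (walnut_term g a b f k) f) summable_on UNIV"
      by (auto simp: summable_on_def)
  qed
  have "?quad \<longleftrightarrow> ?ident" by (intro ball_cong refl frame_identity_iff)
  with weak_unif unif_norm norm_weak unif_quad quad_unif show ?thesis by blast
qed

end
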